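(* For real $\lambda$ with $0<\lambda<1$ let $$G(\lambda)=(1-\zeta)\int_{\{(x,y)\in\mathbb{R}^2\,:\,0<x<y<1\}}\frac{dx\wedge dy}{\{y(y-x)(1-x)(1-\lambda x)\}^{2/3}},$$ where $\{\cdot\}^{2/3}$ denotes the square of the positive real cube root. Then $G$ extends to a multivalued holomorphic function on $T=\mathbb{P}^1\setminus\{0,1,\infty\}$ satisfying the differential equation $$\lambda(1-\lambda)\frac{d^2G}{d\lambda^2}+\left(1-\frac{7}{3}\lambda\right)\frac{dG}{d\lambda}-\frac49G(\lambda)=\frac{1-\zeta}{\lambda-1}.$$
   Context: $\zeta=\exp(2\pi\sqrt{-1}/3)$. The (improper) integral is taken with the standard orientation of $\mathbb{R}^2$. *)

theory Defs
  imports "HOL-Complex_Analysis.Complex_Analysis"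
begin

type_synonym function_element = "complex set \<times> (complex \<Rightarrow> complex)"

definition function_element :: "function_element \<Rightarrow> bool" where
  "function_element e \<longleftrightarrow>
     open (fst e) \<and> connected (fst e) \<and> fst e \<noteq> {} \<and> snd e holomorphic_on fst e"

text \<open>Analytic continuation along a path: elements \<open>E t\<close>, \<open>0 \<le> t \<le> 1\<close>, with \<open>\<gamma> t\<close> in the domain
  of \<open>E t\<close>, such that for \<open>s\<close> close to \<open>t\<close> the elements \<open>E s\<close> and \<open>E t\<close> have the same germ
  at \<open>\<gamma> s\<close>.\<close>

definition analytic_continuation_along ::
    "(real \<Rightarrow> complex) \<Rightarrow> (real \<Rightarrow> function_element) \<Rightarrow> bool" where
  "analytic_continuation_along \<gamma> E \<longleftrightarrow>
     path \<gamma> \<and>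
     (\<forall>t\<in>{0..1}. function_element (E t) \<and> \<gamma> t \<in> fst (E t) \<and>
        (\<exists>\<delta>>0. \<forall>s\<in>{0..1}. \<bar>s - t\<bar> < \<delta> \<longrightarrow>
           \<gamma> s \<in> fst (E t) \<and> (\<forall>\<^sub>F z in nhds (\<gamma> s). snd (E s) z = snd (E t) z)))"

text \<open>A multivalued holomorphic function on \<open>T\<close> is represented by its branches: a nonempty set of
  function elements over \<open>T\<close>, any two of which are analytic continuations of each other along a
  path in \<open>T\<close>, and each of which can be continued, within the set, along every path in \<open>T\<close> that
  starts in its domain.\<close>

definition multivalued_holomorphic_on :: "complex set \<Rightarrow> function_element set \<Rightarrow> bool" where
  "multivalued_holomorphic_on T M \<longleftrightarrow>
     M \<noteq> {} \<and>
     (\<forall>e\<in>M. function_element e \<and> fst e \<subseteq> T) \<and>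
     (\<forall>e\<in>M. \<forall>e'\<in>M. \<exists>\<gamma> E. path_image \<gamma> \<subseteq> T \<and> analytic_continuation_along \<gamma> E \<and>
        E 0 = e \<and> E 1 = e') \<and>
     (\<forall>e\<in>M. \<forall>\<gamma>. path \<gamma> \<and> path_image \<gamma> \<subseteq> T \<and> pathstart \<gamma> \<in> fst e \<longrightarrow>
        (\<exists>E. analytic_continuation_along \<gamma> E \<and> E 0 = e \<and> (\<forall>t\<in>{0..1}. E t \<in> M)))"

definition zeta :: complex where
  "zeta = exp (2 * of_real pi * \<i> / 3)"

definition Delta :: "(real \<times> real) set" where
  "Delta = {(x, y). 0 < x \<and> x < y \<and> y < 1}"

definition G_integrand :: "real \<Rightarrow> real \<times> real \<Rightarrow> real" where
  "G_integrand l = (\<lambda>(x, y). 1 / (root 3 (y * (y - x) * (1 - x) * (1 - l * x)))\<^sup>2)"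

text \<open>The integrand is positive on \<open>Delta\<close>, so the improper integral is the Lebesgue integral.\<close>

definition G :: "real \<Rightarrow> complex" where
  "G l = (1 - zeta) * of_real (LINT p:Delta|lborel. G_integrand l p)"

end

(* The linear substitution x = y v turns the double integral into one over the unit square, and the
   binomial series of (1 - l x)^(-2/3) expands G into a power series in l whose coefficients are
   pochhammer (2/3) n / n! times the moments of x^n.  Integrating the y-derivative of
   y^(n + 2/3) (1 - v y)^(1/3) gives a recurrence between consecutive moments whose inhomogeneity is
   a Beta value; in terms of the coefficients it is the inhomogeneous hypergeometric equation.

   For the continuation, the Taylor coefficients at a of any solution obey a second-order recurrence
   that bounds them by C K^n with K uniform for a in a compact subset of T.  Hence every local
   solution extends to a disc of uniform radius, and finitely many discs cover a path.  The branches
   are all solutions linked to G by finite chains of elements with a common germ. *)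
theory Submission
  imports Defs
begin

section \<open>Analytic continuation along paths\<close>

text \<open>The equation is hypergeometric with both upper parameters \<open>2/3\<close> and lower
  parameter \<open>1\<close>. Its right-hand side comes from the Beta value: the weights
  \<open>pochhammer (2/3) n / n!\<close> turn it into exactly \<open>-1\<close> for every
  \<open>n\<close>, and \<open>-(1 + l + l^2 + ...) = 1 / (l - 1)\<close>. The product
  \<open>y^(n + 2/3) (1 - v y)^(1/3)\<close> raises both exponents of the \<open>n\<close>-th
  integrand by one, so its \<open>y\<close>-derivative is that integrand times a linear function of
  \<open>v y\<close>, that is, a combination of two consecutive integrands. The expansion is made at
  \<open>0\<close>, which is outside \<open>T\<close>. There the leading coefficient vanishes and
  the second-order recurrence drops to first order, which is what the moments satisfy. The resulting
  germ is then restricted to a disc inside \<open>T\<close>. The obstacle to continuation is that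
  discs might shrink along a path. Linearity prevents this: the particular solution enters the
  coefficient bound only through \<open>C\<close>, whereas \<open>K\<close> depends only on the
  distance of \<open>a\<close> from \<open>0\<close> and \<open>1\<close> and on the size of
  \<open>a\<close>.\<close>

lemma analytic_continuation_along_join:
  assumes "analytic_continuation_along \<gamma>1 E1" "analytic_continuation_along \<gamma>2 E2"
    and fin: "pathfinish \<gamma>1 = pathstart \<gamma>2" and E: "E1 1 = E2 0"
  shows "analytic_continuation_along (\<gamma>1 +++ \<gamma>2) (\<lambda>t. if t \<le> 1/2 then E1 (2 * t) else E2 (2 * t - 1))"
    (is "analytic_continuation_along ?g ?E")
proof -
  have p: "path \<gamma>1" "path \<gamma>2" using assms by (auto simp: analytic_continuation_along_def)
  have loc1: "\<exists>\<delta>>0. \<forall>s\<in>{0..1}. \<bar>s - t\<bar> < \<delta> \<longrightarrow>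
      \<gamma>1 s \<in> fst (E1 t) \<and> (\<forall>\<^sub>F z in nhds (\<gamma>1 s). snd (E1 s) z = snd (E1 t) z)"
    and f1: "function_element (E1 t) \<and> \<gamma>1 t \<in> fst (E1 t)" if "t \<in> {0..1}" for t
    using assms(1) that unfolding analytic_continuation_along_def by blast+
  have loc2: "\<exists>\<delta>>0. \<forall>s\<in>{0..1}. \<bar>s - t\<bar> < \<delta> \<longrightarrow>
      \<gamma>2 s \<in> fst (E2 t) \<and> (\<forall>\<^sub>F z in nhds (\<gamma>2 s). snd (E2 s) z = snd (E2 t) z)"
    and f2: "function_element (E2 t) \<and> \<gamma>2 t \<in> fst (E2 t)" if "t \<in> {0..1}" for t
    using assms(2) that unfolding analytic_continuation_along_def by blast+
  have mid: "\<gamma>1 1 = \<gamma>2 0" using fin by (simp add: pathfinish_def pathstart_def)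
  have "function_element (?E t) \<and> ?g t \<in> fst (?E t) \<and>
      (\<exists>\<delta>>0. \<forall>s\<in>{0..1}. \<bar>s - t\<bar> < \<delta> \<longrightarrow>
        ?g s \<in> fst (?E t) \<and> (\<forall>\<^sub>F z in nhds (?g s). snd (?E s) z = snd (?E t) z))"
    if t: "t \<in> {0..1}" for t
  proof (intro conjI)
    show "function_element (?E t)" "?g t \<in> fst (?E t)"
      using t f1[of "2 * t"] f2[of "2 * t-1"] by (auto simp: joinpaths_def)
    consider "t < 1/2" | "t = 1/2" | "t > 1/2" by linarith
    then show "\<exists>\<delta>>0. \<forall>s\<in>{0..1}. \<bar>s - t\<bar> < \<delta> \<longrightarrow>
        ?g s \<in> fst (?E t) \<and> (\<forall>\<^sub>F z in nhds (?g s). snd (?E s) z = snd (?E t) z)"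
    proof cases
      case 1
      obtain d where d: "d > 0" "\<And>s. s \<in> {0..1} \<Longrightarrow> \<bar>s - 2 * t\<bar> < d \<Longrightarrow>
          \<gamma>1 s \<in> fst (E1 (2 * t)) \<and> (\<forall>\<^sub>F z in nhds (\<gamma>1 s). snd (E1 s) z = snd (E1 (2 * t)) z)"
        using loc1[of "2 * t"] t 1 by auto
      \<comment> \<open>Each half is run at double speed, hence \<open>d / 2\<close>; the bound
        \<open>1/2 - t\<close> keeps \<open>s\<close> in the same half as \<open>t\<close>.\<close>
      show ?thesis
      proof (intro exI[of _ "min (d/2) (1/2 - t)"] conjI ballI impI)
        show "0 < min (d / 2) (1 / 2 - t)" using d 1 by simp
        fix s assume s: "s \<in> {0..1::real}" "\<bar>s - t\<bar> < min (d / 2) (1 / 2 - t)"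
        then have "0 \<le> s" "\<bar>s - t\<bar> < d / 2" "\<bar>s - t\<bar> < 1 / 2 - t" by auto
        then have s2: "s \<le> 1/2" "2 * s \<in> {0..1}" "\<bar>2 * s - 2 * t\<bar> < d"
          unfolding atLeastAtMost_iff by linarith+
        show "?g s \<in> fst (?E t)" "\<forall>\<^sub>F z in nhds (?g s). snd (?E s) z = snd (?E t) z"
          using d(2)[OF s2(2,3)] s2(1) 1 by (auto simp: joinpaths_def)
      qed
    next
      case 3
      obtain d where d: "d > 0" "\<And>s. s \<in> {0..1} \<Longrightarrow> \<bar>s - (2 * t-1)\<bar> < d \<Longrightarrow>
          \<gamma>2 s \<in> fst (E2 (2 * t-1)) \<and> (\<forall>\<^sub>F z in nhds (\<gamma>2 s). snd (E2 s) z = snd (E2 (2 * t-1)) z)"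
        using loc2[of "2 * t-1"] t 3 by auto
      show ?thesis
      proof (intro exI[of _ "min (d/2) (t - 1/2)"] conjI ballI impI)
        show "0 < min (d / 2) (t - 1 / 2)" using d 3 by simp
        fix s assume s: "s \<in> {0..1::real}" "\<bar>s - t\<bar> < min (d / 2) (t - 1 / 2)"
        then have "s \<le> 1" "\<bar>s - t\<bar> < d / 2" "\<bar>s - t\<bar> < t - 1 / 2" by auto
        then have s2: "\<not> s \<le> 1/2" "2 * s-1 \<in> {0..1}" "\<bar>(2 * s-1) - (2 * t-1)\<bar> < d"
          unfolding atLeastAtMost_iff by linarith+
        show "?g s \<in> fst (?E t)" "\<forall>\<^sub>F z in nhds (?g s). snd (?E s) z = snd (?E t) z"
          using d(2)[OF s2(2,3)] s2(1) 3 by (auto simp: joinpaths_def)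
      qed
    next
      case 2
      \<comment> \<open>At the junction \<open>E1 1\<close> and \<open>E2 0\<close> are equal as
        elements, so both sides are compared with the same one: \<open>d1\<close> controls
        \<open>s <= 1/2\<close> and \<open>d2\<close> the rest.\<close>
      have Et: "?E t = E1 1" unfolding 2 by simp
      obtain d1 where d1: "d1 > 0" "\<And>s. s \<in> {0..1} \<Longrightarrow> \<bar>s - 1\<bar> < d1 \<Longrightarrow>
          \<gamma>1 s \<in> fst (E1 1) \<and> (\<forall>\<^sub>F z in nhds (\<gamma>1 s). snd (E1 s) z = snd (E1 1) z)"
        using loc1[of 1] by auto
      obtain d2 where d2: "d2 > 0" "\<And>s. s \<in> {0..1} \<Longrightarrow> \<bar>s - 0\<bar> < d2 \<Longrightarrow>
          \<gamma>2 s \<in> fst (E2 0) \<and> (\<forall>\<^sub>F z in nhds (\<gamma>2 s). snd (E2 s) z = snd (E2 0) z)"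
        using loc2[of 0] by auto
      show ?thesis
      proof (intro exI[of _ "min (d1/2) (d2/2)"] conjI ballI impI)
        show "0 < min (d1 / 2) (d2 / 2)" using d1 d2 by simp
        fix s assume s: "s \<in> {0..1::real}" "\<bar>s - t\<bar> < min (d1/2) (d2/2)"
        show "?g s \<in> fst (?E t)" "\<forall>\<^sub>F z in nhds (?g s). snd (?E s) z = snd (?E t) z"
          unfolding Et using d1(2)[of "2 * s"] d2(2)[of "2 * s-1"] s 2 E mid
          by (auto simp: joinpaths_def)
      qed
    qed
  qed
  then show ?thesis using p fin unfolding analytic_continuation_along_def by auto
qed

text \<open>Agreement is asked near one point only: the overlap of two domains may be disconnected,
  and the functions may differ on its other components.\<close>

definition germ_related :: "function_element \<Rightarrow> function_element \<Rightarrow> bool" where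
  "germ_related e e' \<longleftrightarrow>
     (\<exists>z\<in>fst e \<inter> fst e'. \<forall>\<^sub>F w in nhds z. snd e w = snd e' w)"

lemma germ_related_sym: "germ_related e e' \<Longrightarrow> germ_related e' e"
  unfolding germ_related_def Int_commute[of "fst e'"] eq_commute[of "snd e' _"] .

text \<open>A connected open domain contains a path from \<open>p\<close> to a point where the germs
  agree. The start \<open>p\<close> is arbitrary so that such pieces can be concatenated.\<close>

lemma germ_related_continuation:
  assumes e: "function_element e" and e': "function_element e'" and r: "germ_related e e'"
    and p: "p \<in> fst e"
  obtains \<gamma> E where "path_image \<gamma> \<subseteq> fst e" "analytic_continuation_along \<gamma> E"
    "pathstart \<gamma> = p" "E 0 = e" "E 1 = e'"
proof -
  obtain q where q: "q \<in> fst e" "q \<in> fst e'" "\<forall>\<^sub>F w in nhds q. snd e w = snd e' w"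
    using r by (auto simp: germ_related_def)
  have oc: "open (fst e)" "open (fst e')" "connected (fst e)"
    using e e' by (auto simp: function_element_def)
  then have "path_connected (fst e)" using connected_open_path_connected by blast
  then obtain g where g: "path g" "path_image g \<subseteq> fst e" "pathstart g = p" "pathfinish g = q"
    using p q unfolding path_connected_def by blast
  have gin: "g s \<in> fst e" if "s \<in> {0..1}" for s using g(2) that by (auto simp: path_image_def)
  have g1: "g 1 = q" using g(4) by (simp add: pathfinish_def)
  obtain U where U: "open U" "q \<in> U" "\<And>w. w \<in> U \<Longrightarrow> snd e w = snd e' w" "U \<subseteq> fst e'"
    using q oc unfolding eventually_nhds
    by (metis IntE Int_iff inf_le2 open_Int)
  obtain \<epsilon> where \<epsilon>: "\<epsilon> > 0" "ball q \<epsilon> \<subseteq> U" using U(1,2) open_contains_ball by blast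
  have "continuous_on {0..1} g" using g(1) by (simp add: path_def)
  then obtain d where d0: "d > 0" "\<And>s. s \<in> {0..1} \<Longrightarrow> dist s 1 < d \<Longrightarrow> dist (g s) (g 1) < \<epsilon>"
    using \<epsilon>(1) unfolding continuous_on_iff by (metis atLeastAtMost_iff order_refl zero_le_one)
  have d: "g s \<in> U" if "s \<in> {0..1}" "\<bar>s - 1\<bar> < d" for s
    using d0(2)[OF that(1)] that(2) \<epsilon>(2) g1 by (auto simp: dist_real_def dist_commute subset_iff)
  \<comment> \<open>The element changes only at the endpoint. This is a legitimate continuation
    because the path lies in \<open>U\<close> for parameters near \<open>1\<close>, where both
    functions coincide.\<close>
  let ?E = "\<lambda>t::real. if t < 1 then e else e'"
  have evU: "\<forall>\<^sub>F z in nhds w. snd e z = snd e' z" if "w \<in> U" for w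
    using U that unfolding eventually_nhds by blast
  have "function_element (?E t) \<and> g t \<in> fst (?E t) \<and>
      (\<exists>\<delta>>0. \<forall>s\<in>{0..1}. \<bar>s - t\<bar> < \<delta> \<longrightarrow>
        g s \<in> fst (?E t) \<and> (\<forall>\<^sub>F z in nhds (g s). snd (?E s) z = snd (?E t) z))"
    if t: "t \<in> {0..1}" for t
  proof (cases "t < 1")
    case True
    have "\<forall>s\<in>{0..1}. \<bar>s - t\<bar> < 1 - t \<longrightarrow>
        g s \<in> fst (?E t) \<and> (\<forall>\<^sub>F z in nhds (g s). snd (?E s) z = snd (?E t) z)"
      using True gin by auto
    then show ?thesis using True e gin[OF t] by (auto intro!: exI[of _ "1 - t"])
  next
    case False
    then have t1: "t = 1" using t by simp
    have "\<forall>s\<in>{0..1}. \<bar>s - t\<bar> < d \<longrightarrow>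
        g s \<in> fst (?E t) \<and> (\<forall>\<^sub>F z in nhds (g s). snd (?E s) z = snd (?E t) z)"
      using t1 d U(4) evU by auto
    moreover have "function_element (?E t) \<and> g t \<in> fst (?E t)" using t1 e' q(2) g1 by simp
    ultimately show ?thesis using d0(1) by blast
  qed
  then have "analytic_continuation_along g ?E"
    using g(1) unfolding analytic_continuation_along_def by blast
  then show ?thesis using that[of g ?E] g by auto
qed

text \<open>In \<open>ext\<close> the radius depends on \<open>C\<close> alone and not on the
  element, so the discs cannot shrink along a path. Each new disc shares a germ with its
  predecessor, hence the continuation never leaves the component.\<close>

lemma multivalued_holomorphic_on_component:
  fixes S :: "function_element \<Rightarrow> bool" and T :: "complex set"
  assumes elt: "\<And>e. S e \<Longrightarrow> function_element e \<and> fst e \<subseteq> T"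
    and ext: "\<And>C. compact C \<Longrightarrow> C \<subseteq> T \<Longrightarrow>
      \<exists>r>0. \<forall>e z. S e \<longrightarrow> z \<in> C \<inter> fst e \<longrightarrow>
        (\<exists>h. S (ball z r, h) \<and> (\<forall>\<^sub>F w in nhds z. snd e w = h w))"
    and e0: "S e0"
  shows "multivalued_holomorphic_on T
    {e. (\<lambda>e e'. S e \<and> S e' \<and> germ_related e e')\<^sup>*\<^sup>* e0 e}" (is "multivalued_holomorphic_on T ?M")
proof -
  let ?R = "\<lambda>e e'. S e \<and> S e' \<and> germ_related e e'"
  have SM: "S e" if "e \<in> ?M" for e
  proof -
    have "?R\<^sup>*\<^sup>* e0 e" using that by simp
    then show ?thesis by (cases rule: rtranclp.cases) (use e0 in auto)
  qed
  have sym: "?R\<^sup>*\<^sup>* e' e" if "?R\<^sup>*\<^sup>* e e'" for e e'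
  proof -
    have "symp ?R" using germ_related_sym by (auto intro!: sympI)
    from sympD[OF symp_rtranclp[OF this] that] show ?thesis .
  qed
  have conn: "\<exists>\<gamma> E. path_image \<gamma> \<subseteq> T \<and> analytic_continuation_along \<gamma> E \<and> E 0 = e \<and> E 1 = e'"
    if "?R\<^sup>*\<^sup>* e e'" "S e" for e e'
    using that(1)
  proof (induction rule: rtranclp_induct)
    case base
    have fe: "function_element e" "fst e \<subseteq> T" using elt that(2) by auto
    then obtain p where p: "p \<in> fst e" by (auto simp: function_element_def)
    \<comment> \<open>Even the trivial chain needs an actual path; \<open>e\<close> is related to
      itself at any point of its nonempty domain.\<close>
    then have "germ_related e e" by (auto simp: germ_related_def)
    then obtain \<gamma> E where "path_image \<gamma> \<subseteq> fst e" "analytic_continuation_along \<gamma> E" "E 0 = e" "E 1 = e"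
      using germ_related_continuation[OF fe(1) fe(1) _ p] by metis
    then show ?case using fe by blast
  next
    case (step y z)
    then obtain \<gamma> E where 1: "path_image \<gamma> \<subseteq> T" "analytic_continuation_along \<gamma> E" "E 0 = e" "E 1 = y"
      by blast
    then have p: "\<gamma> 1 \<in> fst y"
      unfolding analytic_continuation_along_def by (metis atLeastAtMost_iff order_refl zero_le_one)
    obtain \<gamma>' E' where 2: "path_image \<gamma>' \<subseteq> fst y" "analytic_continuation_along \<gamma>' E'"
      "pathstart \<gamma>' = \<gamma> 1" "E' 0 = y" "E' 1 = z"
      using germ_related_continuation[OF _ _ _ p] elt step(2) by metis
    have "analytic_continuation_along (\<gamma> +++ \<gamma>') (\<lambda>t. if t \<le> 1/2 then E (2 * t) else E' (2 * t - 1))"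
      using analytic_continuation_along_join[OF 1(2) 2(2)] 1 2 by (simp add: pathfinish_def)
    moreover have "path_image (\<gamma> +++ \<gamma>') \<subseteq> T"
      using 1(1) 2(1) elt[of y] step(2) by (intro subset_path_image_join) blast+
    ultimately show ?case using 1(3) 2(5)
      by (intro exI[of _ "\<gamma> +++ \<gamma>'"] exI[of _ "\<lambda>t. if t \<le> 1/2 then E (2 * t) else E' (2 * t - 1)"]) simp
  qed
  have cont: "\<exists>E. analytic_continuation_along \<gamma> E \<and> E 0 = e \<and> (\<forall>t\<in>{0..1}. E t \<in> ?M)"
    if e: "e \<in> ?M" and \<gamma>: "path \<gamma>" "path_image \<gamma> \<subseteq> T" "pathstart \<gamma> \<in> fst e" for e \<gamma>
  proof -
    let ?C = "path_image \<gamma>"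
    have "compact ?C" using \<gamma>(1) by (rule compact_path_image)
    from ext[OF this \<gamma>(2)] obtain r where r: "r > 0" and
      ex: "\<And>e z. S e \<Longrightarrow> z \<in> ?C \<Longrightarrow> z \<in> fst e \<Longrightarrow>
        \<exists>h. S (ball z r, h) \<and> (\<forall>\<^sub>F w in nhds z. snd e w = h w)" by blast
    have \<gamma>C: "\<gamma> t \<in> ?C" if "t \<in> {0..1}" for t using that by (auto simp: path_image_def)
    have c\<gamma>: "continuous_on {0..1} \<gamma>" using \<gamma>(1) by (simp add: path_def)
    then have "uniformly_continuous_on {0..1} \<gamma>" by (intro compact_uniformly_continuous) auto
    then obtain d where d: "d > 0" "\<And>s t. s \<in> {0..1} \<Longrightarrow> t \<in> {0..1} \<Longrightarrow> dist s t < d \<Longrightarrow> dist (\<gamma> s) (\<gamma> t) < r"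
      using r unfolding uniformly_continuous_on_def by metis
    obtain n where n: "n > 0" "1 / real n < d"
      using d(1) by (metis nat_approx_posE zero_less_Suc of_nat_Suc)
    \<comment> \<open>\<open>es (Suc k)\<close> continues the path over the \<open>k\<close>-th of \<open>n\<close> equal parameter intervals, which are
      taken half-open on the left so that \<open>E t = es \<lceil>n t\<rceil>\<close> starts at \<open>e\<close>.\<close>
    define a where "a k = \<gamma> (real k / real n)" for k
    define nx where "nx k e' = (ball (a k) r, SOME h. S (ball (a k) r, h) \<and>
        (\<forall>\<^sub>F w in nhds (a k). snd e' w = h w))" for k and e' :: function_element
    define es where "es = rec_nat e nx"
    have es0: "es 0 = e" and esS: "es (Suc k) = nx k (es k)" for k by (simp_all add: es_def)
    \<comment> \<open>The disc is fixed outside the choice operator, so its shape is known before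
      the choice is shown to succeed.\<close>
    have dom: "fst (es (Suc k)) = ball (a k) r" for k by (simp add: esS nx_def)
    have near: "\<gamma> t \<in> ball (a k) r" if "k < n" "real k / n \<le> t" "t \<le> real (Suc k) / n" for k t
    proof -
      have k1: "real (Suc k) / n \<le> 1" using that(1) n by simp
      have "t - real k / n \<le> 1 / n" using that(3) by (simp add: add_divide_distrib)
      then have "dist (real k / n) t < d" using n that(2) by (simp add: dist_real_def)
      moreover have "real k / n \<in> {0..1}" using that(1) by simp
      moreover have "0 \<le> real k / n" by simp
      then have "t \<in> {0..1}"
        using order_trans[OF _ that(2)] order_trans[OF that(3) k1] by simp
      ultimately show ?thesis using d(2) by (simp add: a_def)
    qed
    have ain: "a k \<in> fst (es k)" if "k \<le> n" for k
    proof (cases k)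
      case 0 then show ?thesis using \<gamma>(3) es0 by (simp add: a_def pathstart_def)
    next
      case (Suc j)
      then show ?thesis unfolding Suc dom unfolding a_def[of "Suc j"]
        using near[of j "real (Suc j) / n"] that Suc by (simp add: divide_right_mono)
    qed
    have step: "S (es (Suc k)) \<and> (\<forall>\<^sub>F w in nhds (a k). snd (es k) w = snd (es (Suc k)) w)"
      if "k < n" "S (es k)" for k
    proof -
      have "a k \<in> ?C" using that(1) unfolding a_def by (intro \<gamma>C) auto
      from ex[OF that(2) this ain] that(1)
      have "\<exists>h. S (ball (a k) r, h) \<and> (\<forall>\<^sub>F w in nhds (a k). snd (es k) w = h w)" by simp
      from someI_ex[OF this] show ?thesis unfolding esS nx_def by simp
    qed
    have esM: "es k \<in> ?M" if "k \<le> n" for k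
      using that
    proof (induction k)
      case 0 then show ?case using e es0 by simp
    next
      case (Suc k)
      then have k: "k < n" "es k \<in> ?M" by auto
      note s = step[OF k(1) SM[OF k(2)]]
      have "germ_related (es k) (es (Suc k))"
        unfolding germ_related_def dom using s ain[of k] k(1) r by (intro bexI[of _ "a k"]) auto
      then have "?R (es k) (es (Suc k))" using s SM[OF k(2)] by blast
      then show ?case using k(2) by (auto intro: rtranclp.rtrancl_into_rtrancl)
    qed
    define E where "E t = es (nat \<lceil>real n * t\<rceil>)" for t
    have cn: "nat \<lceil>real n * t\<rceil> \<le> n" if "t \<in> {0..1}" for t
      using that n by (simp add: ceiling_le_iff nat_le_iff mult_left_le)
    have loc: "\<gamma> t \<in> fst (E t) \<and>
        (\<exists>\<delta>>0. \<forall>s\<in>{0..1}. \<bar>s - t\<bar> < \<delta> \<longrightarrow>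
          \<gamma> s \<in> fst (E t) \<and> (\<forall>\<^sub>F z in nhds (\<gamma> s). snd (E s) z = snd (E t) z))"
      if t: "t \<in> {0..1}" for t
    proof -
      define m where "m = nat \<lceil>real n * t\<rceil>"
      have mn: "m \<le> n" using cn[OF t] by (simp add: m_def)
      have mt: "real n * t \<le> m" using t unfolding m_def by (simp add: of_nat_nat)
      have mt': "real m < real n * t + 1" unfolding m_def using t
        by (simp add: of_nat_nat) linarith
      have Et: "E t = es m" by (simp add: E_def m_def)
      have gt: "\<gamma> t \<in> fst (es m)"
      proof (cases m)
        case 0
        then have "t = 0" using mt t n by (simp add: mult_le_0_iff)
        then show ?thesis using 0 \<gamma>(3) es0 by (simp add: pathstart_def)
      next
        case (Suc j)
        have "\<gamma> t \<in> ball (a j) r"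
          using mt mt' Suc mn n by (intro near) (auto simp: field_simps)
        then show ?thesis using Suc dom by simp
      qed
      have op: "open (fst (es m))" using elt[OF SM[OF esM[OF mn]]] by (simp add: function_element_def)
      \<comment> \<open>If \<open>t\<close> is a grid point \<open>m / n\<close>, parameters just
        after \<open>t\<close> already use \<open>es (Suc m)\<close>; \<open>U\<close> is then
        shrunk to where this element agrees with \<open>es m\<close>.\<close>
      obtain U where U: "open U" "\<gamma> t \<in> U" "U \<subseteq> fst (es m)"
        "real n * t = m \<Longrightarrow> m < n \<Longrightarrow> (\<forall>w\<in>U. snd (es m) w = snd (es (Suc m)) w)"
      proof (cases "real n * t = m \<and> m < n")
        case True
        then have "real m / real n = t" using n by (simp add: field_simps)
        then have "a m = \<gamma> t" by (simp add: a_def)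
        then obtain V where V: "open V" "\<gamma> t \<in> V" "\<And>w. w \<in> V \<Longrightarrow> snd (es m) w = snd (es (Suc m)) w"
          using step[of m] SM[OF esM[OF mn]] True unfolding eventually_nhds by auto
        show ?thesis using V op gt by (intro that[of "V \<inter> fst (es m)"]) auto
      next
        case False
        then show ?thesis using op gt that by blast
      qed
      obtain d1 where d1: "d1 > 0" "\<And>s. s \<in> {0..1} \<Longrightarrow> \<bar>s - t\<bar> < d1 \<Longrightarrow> \<gamma> s \<in> U"
      proof -
        obtain \<epsilon> where "\<epsilon> > 0" "ball (\<gamma> t) \<epsilon> \<subseteq> U" using U open_contains_ball by blast
        moreover obtain d1 where "d1 > 0" "\<And>s. s \<in> {0..1} \<Longrightarrow> dist s t < d1 \<Longrightarrow> dist (\<gamma> s) (\<gamma> t) < \<epsilon>"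
          using c\<gamma> t \<open>\<epsilon> > 0\<close> unfolding continuous_on_iff by metis
        ultimately show ?thesis
          by (intro that[of d1]) (auto simp: dist_real_def dist_commute subset_iff)
      qed
      \<comment> \<open>The first bound keeps \<open>n * s\<close> above \<open>m - 1\<close>. The
        second keeps it below \<open>m + 1\<close> at a grid point and below \<open>m\<close>
        elsewhere, so the index can only be \<open>m\<close>, or \<open>Suc m\<close> after a grid
        point.\<close>
      define d2 where "d2 = min ((real n * t + 1 - m) / n)
        (if real n * t = m then 1 / n else (m - real n * t) / n)"
      have d2: "d2 > 0" using mt mt' n by (auto simp: d2_def)
      have idx: "nat \<lceil>real n * s\<rceil> = m \<or> (real n * t = m \<and> m < n \<and> nat \<lceil>real n * s\<rceil> = Suc m)"
        if s: "s \<in> {0..1}" "\<bar>s - t\<bar> < d2" for s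
      proof -
        have l: "real n * s > real m - 1"
        proof -
          have "t - s < (real n * t + 1 - m) / n" using s by (auto simp: d2_def)
          then show ?thesis using n by (simp add: field_simps)
        qed
        have ub: "real n * s < m + 1" and ub': "real n * t \<noteq> m \<Longrightarrow> real n * s < m"
        proof -
          have u: "s - t < (if real n * t = m then 1 / n else (m - real n * t) / n)"
            using s by (auto simp: d2_def)
          show "real n * s < m + 1" "real n * t \<noteq> m \<Longrightarrow> real n * s < m"
            using u n mt by (auto simp: field_simps split: if_splits)
        qed
        show ?thesis
        proof (cases "real n * s \<le> m")
          case True
          then have "\<lceil>real n * s\<rceil> = int m" using l by (intro ceiling_unique) auto
          then show ?thesis by simp
        next
          case False
          then have "real n * t = m" using ub' by fastforce
          moreover have "\<lceil>real n * s\<rceil> = int (Suc m)" using False ub by (intro ceiling_unique) auto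
          then have "nat \<lceil>real n * s\<rceil> = Suc m" by simp
          ultimately show ?thesis using cn[OF s(1)] by auto
        qed
      qed
      have "\<gamma> s \<in> fst (E t) \<and> (\<forall>\<^sub>F z in nhds (\<gamma> s). snd (E s) z = snd (E t) z)"
        if s: "s \<in> {0..1}" "\<bar>s - t\<bar> < min d1 d2" for s
      proof -
        have sU: "\<gamma> s \<in> U" using d1 s by simp
        then have "\<forall>\<^sub>F z in nhds (\<gamma> s). z \<in> U" using U(1) eventually_nhds by blast
        then have "\<forall>\<^sub>F z in nhds (\<gamma> s). snd (E s) z = snd (E t) z"
          using idx[OF s(1)] s(2) U(4) unfolding Et unfolding E_def
          by (auto elim!: eventually_mono)
        then show ?thesis using sU U(3) Et by auto
      qed
      then show ?thesis using gt Et d1(1) d2 by (auto intro!: exI[of _ "min d1 d2"])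
    qed
    have EM: "E t \<in> ?M" if "t \<in> {0..1}" for t using esM cn that by (simp add: E_def)
    have "analytic_continuation_along \<gamma> E"
      unfolding analytic_continuation_along_def using loc \<gamma>(1) elt SM EM by blast
    moreover have "E 0 = e" by (simp add: E_def es0)
    ultimately show ?thesis using EM by blast
  qed
  have two: "\<exists>\<gamma> E. path_image \<gamma> \<subseteq> T \<and> analytic_continuation_along \<gamma> E \<and> E 0 = e \<and> E 1 = e'"
    if "e \<in> ?M" "e' \<in> ?M" for e e'
    using that by (intro conn[OF rtranclp_trans[OF sym]] SM) auto
  have "e0 \<in> ?M" by simp
  then have ne: "?M \<noteq> {}" by blast
  have "\<forall>e\<in>?M. function_element e \<and> fst e \<subseteq> T" using elt[OF SM] by (rule ballI)
  then show ?thesis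
    unfolding multivalued_holomorphic_on_def
  proof (intro conjI)
    show "\<forall>e\<in>?M. \<forall>e'\<in>?M. \<exists>\<gamma> E. path_image \<gamma> \<subseteq> T \<and> analytic_continuation_along \<gamma> E \<and>
        E 0 = e \<and> E 1 = e'"
      by (intro ballI two)
    show "\<forall>e\<in>?M. \<forall>\<gamma>. path \<gamma> \<and> path_image \<gamma> \<subseteq> T \<and> pathstart \<gamma> \<in> fst e \<longrightarrow>
        (\<exists>E. analytic_continuation_along \<gamma> E \<and> E 0 = e \<and> (\<forall>t\<in>{0..1}. E t \<in> ?M))"
      by (intro ballI allI impI cont; elim conjE; assumption)
  qed (rule ne)
qed

section \<open>Local solutions of the inhomogeneous hypergeometric equation\<close>

unbundle no vec_syntax

text \<open>The equation is multiplied by \<open>z - 1\<close>, so that the defect is holomorphic wherever \<open>g\<close> is and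
  the identity theorem applies also across the singular points \<open>0\<close> and \<open>1\<close>.\<close>

definition hypergeometric_defect :: "(complex \<Rightarrow> complex) \<Rightarrow> complex \<Rightarrow> complex" where
  "hypergeometric_defect g z = (z - 1) *
     (z * (1 - z) * (deriv ^^ 2) g z + (1 - 7 / 3 * z) * deriv g z - 4 / 9 * g z) - (1 - zeta)"

text \<open>The hypergeometric operator in the local variable \<open>z - a\<close>, on Taylor series at \<open>a\<close>.\<close>

definition hypergeometric_fps :: "complex \<Rightarrow> complex fps \<Rightarrow> complex fps" where
  "hypergeometric_fps a F =
     (fps_const (a * (1 - a)) + fps_const (1 - 2 * a) * fps_X - fps_X ^ 2) * fps_deriv (fps_deriv F)
     + (fps_const (1 - 7 / 3 * a) - fps_const (7 / 3) * fps_X) * fps_deriv F - fps_const (4 / 9) * F"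

lemma hypergeometric_defect_eq_0_iff:
  assumes "z \<noteq> 1"
  shows "hypergeometric_defect g z = 0 \<longleftrightarrow>
    z * (1 - z) * (deriv ^^ 2) g z + (1 - 7 / 3 * z) * deriv g z - 4 / 9 * g z = (1 - zeta) / (z - 1)"
  using assms by (simp add: hypergeometric_defect_def eq_divide_eq mult.commute)

lemma deriv_cong_eventually:
  fixes f g :: "complex \<Rightarrow> complex"
  assumes "\<forall>\<^sub>F w in nhds z. f w = g w"
  shows "\<forall>\<^sub>F w in nhds z. deriv f w = deriv g w"
proof -
  obtain U where U: "open U" "z \<in> U" "\<forall>w\<in>U. f w = g w"
    using assms unfolding eventually_nhds by blast
  have "deriv f w = deriv g w" if "w \<in> U" for w
    using U that by (intro deriv_cong_ev) (auto simp: eventually_nhds)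
  then show ?thesis using U unfolding eventually_nhds by blast
qed

lemma hypergeometric_defect_cong_eventually:
  assumes "\<forall>\<^sub>F w in nhds z. f w = g w"
  shows "\<forall>\<^sub>F w in nhds z. hypergeometric_defect f w = hypergeometric_defect g w"
  using assms deriv_cong_eventually[OF assms] deriv_cong_eventually[OF deriv_cong_eventually[OF assms]]
  by eventually_elim (simp add: hypergeometric_defect_def numeral_2_eq_2)

lemma holomorphic_on_hypergeometric_defect:
  assumes "g holomorphic_on S" "open S"
  shows "hypergeometric_defect g holomorphic_on S"
  unfolding hypergeometric_defect_def[abs_def] using assms
  by (auto intro!: holomorphic_intros simp: numeral_2_eq_2)

lemma hypergeometric_defect_identity:
  assumes "g holomorphic_on S" "open S" "connected S" "a \<in> S"
    and ev: "\<forall>\<^sub>F w in nhds a. hypergeometric_defect g w = 0" and "z \<in> S"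
  shows "hypergeometric_defect g z = 0"
proof -
  obtain U where U: "open U" "a \<in> U" "\<And>w. w \<in> U \<Longrightarrow> hypergeometric_defect g w = 0"
    using ev unfolding eventually_nhds by blast
  show ?thesis
    by (rule analytic_continuation_open[of "U \<inter> S" S "hypergeometric_defect g" "\<lambda>_. 0" z])
      (use U assms holomorphic_on_hypergeometric_defect in auto)
qed

lemma has_fps_expansion_hypergeometric_defect:
  assumes F: "(\<lambda>w. g (a + w)) has_fps_expansion F"
  shows "(\<lambda>w. hypergeometric_defect g (a + w)) has_fps_expansion
    ((fps_const (a - 1) + fps_X) * hypergeometric_fps a F - fps_const (1 - zeta))"
proof -
  have shift: "deriv (\<lambda>w. f (a + w)) = (\<lambda>w. deriv f (a + w))" for f :: "complex \<Rightarrow> complex"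
    by (simp add: deriv_shift_0' add_ac o_def fun_eq_iff)
  have F1: "(\<lambda>w. deriv g (a + w)) has_fps_expansion fps_deriv F"
    using has_fps_expansion_deriv[OF F] by (simp only: shift)
  have F2: "(\<lambda>w. deriv (deriv g) (a + w)) has_fps_expansion fps_deriv (fps_deriv F)"
    using has_fps_expansion_deriv[OF F1] by (simp only: shift)
  \<comment> \<open>With \<open>z = a + w\<close> one has
    \<open>z (1 - z) = a (1 - a) + (1 - 2 a) w - w^2\<close>.\<close>
  have "(\<lambda>w. ((a - 1) + w) * ((a * (1 - a) + (1 - 2 * a) * w - w ^ 2) * deriv (deriv g) (a + w)
       + ((1 - 7 / 3 * a) - 7 / 3 * w) * deriv g (a + w) - 4 / 9 * g (a + w)) - (1 - zeta))
     has_fps_expansion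
     ((fps_const (a - 1) + fps_X) * hypergeometric_fps a F - fps_const (1 - zeta))"
    unfolding hypergeometric_fps_def
    by (intro has_fps_expansion_diff has_fps_expansion_add has_fps_expansion_mult
        has_fps_expansion_const has_fps_expansion_fps_X has_fps_expansion_fps_X_power F F1 F2)
  also have "(\<lambda>w. ((a - 1) + w) * ((a * (1 - a) + (1 - 2 * a) * w - w ^ 2) * deriv (deriv g) (a + w)
       + ((1 - 7 / 3 * a) - 7 / 3 * w) * deriv g (a + w) - 4 / 9 * g (a + w)) - (1 - zeta))
     = (\<lambda>w. hypergeometric_defect g (a + w))"
    by (simp add: fun_eq_iff hypergeometric_defect_def numeral_2_eq_2 field_simps)
  finally show ?thesis .
qed

text \<open>The factor of \<open>F $ n\<close> is \<open>-(n (n - 1) + 7/3 n + 4/9)\<close>, a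
  negated square because both upper parameters are \<open>2/3\<close>. For \<open>a = 0\<close> the
  term in \<open>F $ (n + 2)\<close> disappears.\<close>

lemma hypergeometric_fps_nth:
  "hypergeometric_fps a F $ n =
     a * (1 - a) * (of_nat n + 1) * (of_nat n + 2) * F $ (n + 2)
     + (of_nat n + 1) * ((1 - 2 * a) * of_nat n + 1 - 7 / 3 * a) * F $ (n + 1)
     - (of_nat n + 2 / 3) ^ 2 * F $ n"
proof -
  consider "n = 0" | "n = 1" | k where "n = Suc (Suc k)" by (metis One_nat_def not0_implies_Suc)
  then show ?thesis
    by cases (simp_all add: hypergeometric_fps_def ring_distribs mult.assoc fps_X_power_mult_nth
        eval_nat_numeral power2_eq_square field_simps)
qed

text \<open>Uniqueness of Taylor expansions makes the differential equation near \<open>a\<close>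
  the same as an identity of formal power series.\<close>

lemma hypergeometric_defect_eventually_0_iff:
  assumes F: "(\<lambda>w. g (a + w)) has_fps_expansion F"
  shows "(\<forall>\<^sub>F w in nhds a. hypergeometric_defect g w = 0) \<longleftrightarrow>
    (fps_const (a - 1) + fps_X) * hypergeometric_fps a F = fps_const (1 - zeta)"
    (is "_ \<longleftrightarrow> ?D = _")
proof -
  note D = has_fps_expansion_hypergeometric_defect[OF F]
  have "(\<forall>\<^sub>F w in nhds a. hypergeometric_defect g w = 0) \<longleftrightarrow>
      (\<forall>\<^sub>F w in nhds 0. hypergeometric_defect g (a + w) = 0)"
    by (subst nhds_to_0) (simp add: eventually_filtermap add.commute)
  also have "\<dots> \<longleftrightarrow> (\<lambda>w. hypergeometric_defect g (a + w)) has_fps_expansion 0"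
    by (simp add: has_fps_expansion_0_iff)
  also have "\<dots> \<longleftrightarrow> ?D - fps_const (1 - zeta) = 0"
  proof
    show "?D - fps_const (1 - zeta) = 0"
      if "(\<lambda>w. hypergeometric_defect g (a + w)) has_fps_expansion 0"
      using D that by (rule fps_expansion_unique_complex)
    show "(\<lambda>w. hypergeometric_defect g (a + w)) has_fps_expansion 0"
      if "?D - fps_const (1 - zeta) = 0"
      using D unfolding that .
  qed
  finally show ?thesis by simp
qed

section \<open>Uniform coefficient bounds and extension of local solutions\<close>

lemma fps_conv_radius_ge_geometric:
  fixes F :: "complex fps"
  assumes "\<And>n. norm (F $ n) \<le> C * K ^ n" and K: "K > 0"
  shows "fps_conv_radius F \<ge> ereal (1 / K)"
  unfolding fps_conv_radius_def
proof (rule conv_radius_geI_ex')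
  fix r :: real assume r: "0 < r" "ereal r < ereal (1 / K)"
  have "norm (F $ n * of_real r ^ n) \<le> C * (K * r) ^ n" for n
    using mult_right_mono[OF assms(1)[of n], of "r ^ n"] r
    by (simp add: norm_mult norm_power power_mult_distrib mult_ac)
  moreover have "summable (\<lambda>n. C * (K * r) ^ n)"
    using r K by (intro summable_mult summable_geometric) (simp add: field_simps)
  ultimately show "summable (\<lambda>n. F $ n * of_real r ^ n)"
    by (rule summable_comparison_test'[where N = 0, rotated])
qed

text \<open>The base of the geometric bound involves only \<open>m\<close> and \<open>N\<close>. Two
  divisions cost a factor \<open>1 / m\<close>: by \<open>a - 1\<close>, to control the
  inhomogeneity, and by \<open>a * (1 - a)\<close>, to solve for the highest coefficient.\<close>

lemma hypergeometric_fps_bound: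
  fixes a :: complex
  assumes m: "m > 0" "m \<le> norm (a * (1 - a))" "m \<le> norm (a - 1)" and N: "norm a \<le> N"
    and eq: "(fps_const (a - 1) + fps_X) * hypergeometric_fps a F = fps_const c"
  shows "\<exists>C. \<forall>n. norm (F $ n) \<le> C * ((3 + 5 * N) / m + 2) ^ n"
proof -
  \<comment> \<open>The recurrence gives \<open>\<bar>F (n + 2)\<bar> \<le> B (\<bar>R n\<bar> + \<bar>F (n + 1)\<bar> + \<bar>F n\<bar>)\<close>, and \<open>K\<close> is chosen with
    \<open>B K + 2 B \<le> K\<^sup>2\<close>.\<close>
  define B where "B = (3 + 5 * N) / m"
  define K where "K = B + 2"
  define R where "R = hypergeometric_fps a F"
  have N0: "N \<ge> 0" using N norm_ge_zero order_trans by blast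
  have B: "B > 0" "(2 + 5 * N) / m \<le> B" "1 / m \<le> B" using m N0 by (auto simp: B_def divide_simps)
  have K: "K > 0" "B \<le> K" "B * K + 2 * B \<le> K ^ 2"
    using B by (auto simp: K_def power2_eq_square algebra_simps)
  \<comment> \<open>\<open>R\<close> is the expansion of \<open>c / (a - 1 + X)\<close>, a geometric
    series whose ratio has norm \<open>1 / norm (a - 1) <= 1 / m <= K\<close>.\<close>
  have R: "norm (R $ n) \<le> norm (R $ 0) * K ^ n" for n
  proof (induction n)
    case (Suc n)
    have "((fps_const (a - 1) + fps_X) * R) $ Suc n = 0" using eq by (simp add: R_def)
    then have "(a - 1) * R $ Suc n = - R $ n" by (simp add: ring_distribs add_eq_0_iff)
    from arg_cong[OF this, of norm] have "norm (a - 1) * norm (R $ Suc n) = norm (R $ n)"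
      by (simp add: norm_mult)
    then have "m * norm (R $ Suc n) \<le> norm (R $ n)"
      using mult_right_mono[OF m(3), of "norm (R $ Suc n)"] by simp
    then have "norm (R $ Suc n) \<le> (1 / m) * norm (R $ n)" using m by (simp add: field_simps)
    also have "\<dots> \<le> K * norm (R $ n)" using B K by (intro mult_right_mono) auto
    also have "\<dots> \<le> K * (norm (R $ 0) * K ^ n)" using Suc K by (intro mult_left_mono) auto
    finally show ?case by (simp add: mult_ac)
  qed simp
  define C where "C = norm (R $ 0) + norm (F $ 0) + norm (F $ 1) / K"
  have C: "norm (R $ 0) \<le> C" "norm (F $ 0) \<le> C" "norm (F $ 1) \<le> C * K"
    using K by (auto simp: C_def field_simps)
  have "norm (F $ n) \<le> C * K ^ n \<and> norm (F $ Suc n) \<le> C * K ^ Suc n" for n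
  proof (induction n)
    case 0 then show ?case using C by simp
  next
    case (Suc n)
    define x where "x = real n"
    have x: "x \<ge> 0" by (simp add: x_def)
    have Rn: "R $ n = a * (1 - a) * (of_nat n + 1) * (of_nat n + 2) * F $ (n + 2)
      + (of_nat n + 1) * ((1 - 2 * a) * of_nat n + 1 - 7 / 3 * a) * F $ (n + 1)
      - (of_nat n + 2 / 3) ^ 2 * F $ n"
      unfolding R_def by (rule hypergeometric_fps_nth)
    have nn: "norm (of_nat n + of_real r :: complex) = x + r" if "r \<ge> 0" for r
      using x that unfolding x_def
      by (metis abs_of_nonneg add_nonneg_nonneg norm_of_real of_real_add of_real_of_nat_eq)
    have nn': "norm (of_nat n + 1 :: complex) = x + 1" "norm (of_nat n + 2 :: complex) = x + 2"
      "norm (of_nat n + 2/3 :: complex) = x + 2/3"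
      using nn[of 1] nn[of 2] nn[of "2/3"] by (simp_all add: x_def)
    have "norm ((1 - 2 * a) * of_nat n + (1 - 7 / 3 * a)) \<le> (1 + 2 * N) * x + (1 + 7/3 * N)"
    proof (intro norm_triangle_le add_mono)
      have "norm (1 - 2 * a) \<le> norm (1::complex) + norm (2 * a)" by (rule norm_triangle_ineq4)
      also have "\<dots> \<le> 1 + 2 * N" using N by (simp add: norm_mult)
      finally show "norm ((1 - 2 * a) * of_nat n) \<le> (1 + 2 * N) * x"
        using x by (simp add: norm_mult x_def mult_right_mono)
      have "norm (1 - 7 / 3 * a) \<le> norm (1::complex) + norm (7 / 3 * a)" by (rule norm_triangle_ineq4)
      also have "\<dots> \<le> 1 + 7 / 3 * N" using N by (simp add: norm_mult)
      finally show "norm (1 - 7 / 3 * a) \<le> 1 + 7 / 3 * N" .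
    qed
    \<comment> \<open>Bounding by a multiple of \<open>x + 2\<close> lets every term be divided by
      \<open>?u\<close>, which leaves a recurrence with coefficients bounded independently of
      \<open>n\<close>.\<close>
    also have "\<dots> \<le> (2 + 5 * N) * (x + 2)" using x N0 by (simp add: algebra_simps)
    finally have q: "norm ((1 - 2 * a) * of_nat n + 1 - 7 / 3 * a) \<le> (2 + 5 * N) * (x + 2)"
      by (simp add: algebra_simps)
    let ?u = "(x + 1) * (x + 2)"
    have u: "?u \<ge> 1" using x by (simp add: algebra_simps)
    have "a * (1 - a) * (of_nat n + 1) * (of_nat n + 2) * F $ (n + 2) =
        R $ n - (of_nat n + 1) * ((1 - 2 * a) * of_nat n + 1 - 7 / 3 * a) * F $ (n + 1)
        + (of_nat n + 2 / 3) ^ 2 * F $ n" unfolding Rn by simp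
    then have "norm (a * (1 - a)) * ?u * norm (F $ (n + 2)) =
        norm (R $ n - (of_nat n + 1) * ((1 - 2 * a) * of_nat n + 1 - 7 / 3 * a) * F $ (n + 1)
        + (of_nat n + 2 / 3) ^ 2 * F $ n)"
      by (metis (no_types, lifting) nn'(1,2) norm_mult mult.assoc)
    also have "\<dots> \<le> norm (R $ n)
        + norm ((of_nat n + 1) * ((1 - 2 * a) * of_nat n + 1 - 7 / 3 * a) * F $ (n + 1))
        + norm ((of_nat n + 2 / 3) ^ 2 * F $ n)"
      by (intro order_trans[OF norm_triangle_ineq] add_right_mono norm_triangle_ineq4)
    also have "\<dots> \<le> ?u * norm (R $ n) + ?u * ((2 + 5 * N) * norm (F $ (n + 1))) + ?u * norm (F $ n)"
    proof (intro add_mono)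
      show "norm (R $ n) \<le> ?u * norm (R $ n)" using mult_right_mono[OF u, of "norm (R $ n)"] by simp
      have "(x + 1) * norm ((1 - 2 * a) * of_nat n + 1 - 7 / 3 * a) * norm (F $ (n + 1))
          \<le> (x + 1) * ((2 + 5 * N) * (x + 2)) * norm (F $ (n + 1))"
        using q x by (intro mult_right_mono mult_left_mono) auto
      then show "norm ((of_nat n + 1) * ((1 - 2 * a) * of_nat n + 1 - 7 / 3 * a) * F $ (n + 1))
          \<le> ?u * ((2 + 5 * N) * norm (F $ (n + 1)))"
        by (simp only: norm_mult nn' mult_ac)
      have "(x + 2/3)\<^sup>2 \<le> ?u" using x by (simp add: power2_eq_square algebra_simps)
      then show "norm ((of_nat n + 2 / 3) ^ 2 * F $ n) \<le> ?u * norm (F $ n)"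
        by (simp only: norm_mult norm_power nn') (intro mult_right_mono norm_ge_zero)
    qed
    finally have "?u * (norm (a * (1 - a)) * norm (F $ (n + 2))) \<le>
        ?u * (norm (R $ n) + (2 + 5 * N) * norm (F $ (n + 1)) + norm (F $ n))"
      by (simp only: ring_distribs mult_ac)
    then have "norm (a * (1 - a)) * norm (F $ (n + 2)) \<le>
        norm (R $ n) + (2 + 5 * N) * norm (F $ (n + 1)) + norm (F $ n)"
      using u by (subst (asm) mult_le_cancel_left_pos) auto
    then have "m * norm (F $ (n + 2)) \<le>
        norm (R $ n) + (2 + 5 * N) * norm (F $ (n + 1)) + norm (F $ n)"
      using mult_right_mono[OF m(2), of "norm (F $ (n + 2))"] by simp
    then have "norm (F $ (n + 2)) \<le>
        (1/m) * norm (R $ n) + ((2 + 5 * N)/m) * norm (F $ (n + 1)) + (1/m) * norm (F $ n)"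
      using m(1) by (simp add: field_simps)
    also have "\<dots> \<le> B * (C * K ^ n) + B * (C * K ^ Suc n) + B * (C * K ^ n)"
    proof (intro add_mono mult_mono)
      show "norm (R $ n) \<le> C * K ^ n"
        using R[of n] by (rule order_trans) (use C(1) K in \<open>intro mult_right_mono, auto\<close>)
    qed (use Suc B in auto)
    also have "\<dots> = (B * K + 2 * B) * (C * K ^ n)" by (simp add: algebra_simps)
    also have "\<dots> \<le> K ^ 2 * (C * K ^ n)"
      using K order_trans[OF norm_ge_zero C(2)] by (intro mult_right_mono mult_nonneg_nonneg) auto
    finally show ?case using Suc by (simp add: power2_eq_square mult_ac)
  qed
  then show ?thesis unfolding K_def B_def by blast
qed

text \<open>The Taylor series of \<open>f\<close> at \<open>a\<close> converges on the whole disc,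
  and the identity theorem carries the equation there. Only germs at \<open>a\<close> are compared,
  since \<open>U\<close> may meet the disc in several components.\<close>

lemma hypergeometric_solution_extends:
  fixes a :: complex
  assumes m: "m > 0" "m \<le> norm (a * (1 - a))" "m \<le> norm (a - 1)" and N: "norm a \<le> N"
    and f: "f holomorphic_on U" "open U" "a \<in> U" "\<And>z. z \<in> U \<Longrightarrow> hypergeometric_defect f z = 0"
  defines "r \<equiv> 1 / ((3 + 5 * N) / m + 2)"
  obtains h where "h holomorphic_on ball a r" "\<forall>\<^sub>F w in nhds a. f w = h w"
    "\<And>z. z \<in> ball a r \<Longrightarrow> hypergeometric_defect h z = 0"
proof -
  define F where "F = fps_expansion (\<lambda>w. f (a + w)) 0"
  have "open ((\<lambda>w. a + w) -` U)" by (intro open_vimage f(2) continuous_intros)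
  moreover have "(\<lambda>w. f (a + w)) holomorphic_on ((\<lambda>w. a + w) -` U)"
    by (rule holomorphic_on_compose_gen[of "\<lambda>w. a + w" _ f U, unfolded o_def])
      (auto intro!: holomorphic_intros f(1))
  ultimately have F: "(\<lambda>w. f (a + w)) has_fps_expansion F"
    unfolding F_def using f(3) by (intro has_fps_expansion_fps_expansion) auto
  have "\<forall>\<^sub>F w in nhds a. hypergeometric_defect f w = 0"
    using f(2-4) unfolding eventually_nhds by blast
  then have "(fps_const (a - 1) + fps_X) * hypergeometric_fps a F = fps_const (1 - zeta)"
    using hypergeometric_defect_eventually_0_iff[OF F] by simp
  from hypergeometric_fps_bound[OF m N this] obtain C where
    "\<And>n. norm (F $ n) \<le> C * ((3 + 5 * N) / m + 2) ^ n" by blast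
  moreover have "N \<ge> 0" using N norm_ge_zero order_trans by blast
  then have "(3 + 5 * N) / m + 2 > 0" using m by (intro add_nonneg_pos divide_nonneg_pos) auto
  ultimately have rad: "ereal r \<le> fps_conv_radius F" and r: "r > 0"
    unfolding r_def using fps_conv_radius_ge_geometric by auto
  define h where "h = (\<lambda>z. eval_fps F (z - a))"
  have h: "h holomorphic_on ball a r"
    unfolding h_def
  proof (rule holomorphic_on_compose_gen[of "\<lambda>z. z - a" _ "eval_fps F" "eball 0 (fps_conv_radius F)",
        unfolded o_def])
    show "(\<lambda>z. z - a) ` ball a r \<subseteq> eball 0 (fps_conv_radius F)"
      using rad by (auto simp: dist_norm norm_minus_commute intro!: less_le_trans[OF _ rad])
  qed (auto intro!: holomorphic_intros)
  have "\<forall>\<^sub>F w in nhds 0. eval_fps F w = f (a + w)" using F by (simp add: has_fps_expansion_def)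
  then have fh: "\<forall>\<^sub>F w in nhds a. f w = h w"
    by (subst nhds_to_0) (simp add: eventually_filtermap add.commute h_def eq_commute)
  have "\<forall>\<^sub>F w in nhds a. hypergeometric_defect h w = 0"
    using hypergeometric_defect_cong_eventually[OF fh] \<open>\<forall>\<^sub>F w in nhds a. hypergeometric_defect f w = 0\<close>
    by eventually_elim simp
  then have "hypergeometric_defect h z = 0" if "z \<in> ball a r" for z
    using hypergeometric_defect_identity[OF h _ _ _ _ that, of a] r by simp
  then show ?thesis using that h fh by blast
qed

definition solution_element :: "function_element \<Rightarrow> bool" where
  "solution_element e \<longleftrightarrow> function_element e \<and> fst e \<subseteq> UNIV - {0, 1} \<and>
     (\<forall>z\<in>fst e. hypergeometric_defect (snd e) z = 0)"

lemma solution_element_extends: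
  assumes C: "compact C" "C \<subseteq> UNIV - {0, 1}"
  shows "\<exists>r>0. \<forall>e z. solution_element e \<longrightarrow> z \<in> C \<inter> fst e \<longrightarrow>
    (\<exists>h. solution_element (ball z r, h) \<and> (\<forall>\<^sub>F w in nhds z. snd e w = h w))"
proof (cases "C = {}")
  case False
  have "\<exists>z\<in>C. \<forall>w\<in>C. norm (z * (1 - z)) \<le> norm (w * (1 - w))"
    using C False by (intro continuous_attains_inf) (auto intro!: continuous_intros)
  then obtain z1 where z1: "z1 \<in> C" "\<And>w. w \<in> C \<Longrightarrow> norm (z1 * (1 - z1)) \<le> norm (w * (1 - w))" by blast
  have "\<exists>z\<in>C. \<forall>w\<in>C. norm (z - 1) \<le> norm (w - 1)"
    using C False by (intro continuous_attains_inf) (auto intro!: continuous_intros)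
  then obtain z2 where z2: "z2 \<in> C" "\<And>w. w \<in> C \<Longrightarrow> norm (z2 - 1) \<le> norm (w - 1)" by blast
  have "\<exists>z\<in>C. \<forall>w\<in>C. norm z \<le> norm w"
    using C False by (intro continuous_attains_inf) (auto intro!: continuous_intros)
  then obtain z3 where z3: "z3 \<in> C" "\<And>w. w \<in> C \<Longrightarrow> norm z3 \<le> norm w" by blast
  obtain N where N: "\<And>w. w \<in> C \<Longrightarrow> norm w \<le> N" using C compact_imp_bounded bounded_iff by metis
  \<comment> \<open>The first two minima supply the lower bounds for the extension; the last two
    keep a disc of radius at most \<open>m\<close> away from \<open>1\<close> and
    \<open>0\<close>.\<close>
  define m where "m = min (norm (z1 * (1 - z1))) (min (norm (z2 - 1)) (norm z3))"
  have m: "m > 0" using z1(1) z2(1) z3(1) C by (auto simp: m_def)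
  have mC: "m \<le> norm (w * (1 - w))" "m \<le> norm (w - 1)" "m \<le> norm w" if "w \<in> C" for w
    using z1(2) z2(2) z3(2) that by (auto simp: m_def min_le_iff_disj)
  define r0 where "r0 = 1 / ((3 + 5 * N) / m + 2)"
  define r where "r = min r0 m"
  have "N \<ge> 0" using N False norm_ge_zero order_trans by blast
  then have "r0 > 0" unfolding r0_def using m by (intro divide_pos_pos add_nonneg_pos divide_nonneg_pos) auto
  then have r: "r > 0" using m by (simp add: r_def)
  have "\<exists>h. solution_element (ball z r, h) \<and> (\<forall>\<^sub>F w in nhds z. snd e w = h w)"
    if e: "solution_element e" and z: "z \<in> C" "z \<in> fst e" for e z
  proof -
    have e': "snd e holomorphic_on fst e" "open (fst e)" "\<And>w. w \<in> fst e \<Longrightarrow> hypergeometric_defect (snd e) w = 0"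
      using e by (auto simp: solution_element_def function_element_def)
    obtain h where h: "h holomorphic_on ball z r0" "\<forall>\<^sub>F w in nhds z. snd e w = h w"
      "\<And>w. w \<in> ball z r0 \<Longrightarrow> hypergeometric_defect h w = 0"
      using hypergeometric_solution_extends[OF m mC(1,2)[OF z(1)] N[OF z(1)] e'(1,2) z(2) e'(3)]
      unfolding r0_def by metis
    have sub: "ball z r \<subseteq> ball z r0" by (auto simp: r_def)
    have "ball z r \<subseteq> UNIV - {0, 1}" using mC(2,3)[OF z(1)] by (auto simp: r_def dist_norm)
    then have "solution_element (ball z r, h)"
      using h(3) sub holomorphic_on_subset[OF h(1) sub] r
      by (auto simp: solution_element_def function_element_def)
    then show ?thesis using h(2) by blast
  qed
  then show ?thesis using r by blast
qed (auto intro: exI[of _ 1])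

section \<open>The double integral as a power series\<close>

definition unit_square :: "(real \<times> real) set" where
  "unit_square = {0<..<1} \<times> {0<..<1}"

lemma measurable_Delta [measurable]: "Delta \<in> sets borel"
proof -
  have "Delta = {p. 0 < fst p} \<inter> {p. fst p < snd p} \<inter> {p. snd p < 1}" by (auto simp: Delta_def)
  moreover have "open \<dots>" by (intro open_Int open_Collect_less continuous_intros)
  ultimately show ?thesis by simp
qed

lemma measurable_unit_square [measurable]: "unit_square \<in> sets borel"
  unfolding unit_square_def by (intro borel_open open_Times) auto

text \<open>Here \<open>q = (v, y)\<close> and the factor \<open>snd q\<close> is the Jacobian of
  \<open>x = y * v\<close>. For nonnegative functions Tonelli applies before any integrability is
  known.\<close>

lemma nn_integral_Delta:
  fixes h :: "real \<times> real \<Rightarrow> ennreal"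
  assumes [measurable]: "h \<in> borel_measurable borel"
  shows "(\<integral>\<^sup>+p. h p * indicator Delta p \<partial>lborel) =
    (\<integral>\<^sup>+q. ennreal (snd q) * h (snd q * fst q, snd q) * indicator unit_square q \<partial>lborel)"
proof -
  have h[measurable]: "h \<in> borel_measurable (borel \<Otimes>\<^sub>M borel)"
    and D[measurable]: "Delta \<in> sets (borel \<Otimes>\<^sub>M borel)"
    and S[measurable]: "unit_square \<in> sets (borel \<Otimes>\<^sub>M borel)"
    unfolding borel_prod by measurable
  have "(\<integral>\<^sup>+p. h p * indicator Delta p \<partial>lborel) =
      (\<integral>\<^sup>+y. (\<integral>\<^sup>+x. h (x, y) * indicator Delta (x, y) \<partial>lborel) \<partial>lborel)"
    by (subst lborel_pair.nn_integral_snd) (simp_all add: lborel_prod)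
  also have "\<dots> = (\<integral>\<^sup>+y. (\<integral>\<^sup>+v. ennreal y * h (y * v, y) * indicator unit_square (v, y) \<partial>lborel) \<partial>lborel)"
  proof (rule nn_integral_cong)
    fix y :: real
    show "(\<integral>\<^sup>+x. h (x, y) * indicator Delta (x, y) \<partial>lborel) =
        (\<integral>\<^sup>+v. ennreal y * h (y * v, y) * indicator unit_square (v, y) \<partial>lborel)"
    proof (cases "y > 0")
      case True
      have "(\<integral>\<^sup>+x. h (x, y) * indicator Delta (x, y) \<partial>lborel) =
          ennreal y * (\<integral>\<^sup>+v. h (y * v, y) * indicator Delta (y * v, y) \<partial>lborel)"
        using True by (subst nn_integral_real_affine[where c = y and t = 0]) simp_all
      also have "\<dots> = (\<integral>\<^sup>+v. ennreal y * (h (y * v, y) * indicator Delta (y * v, y)) \<partial>lborel)"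
        by (subst nn_integral_cmult) simp_all
      also have "\<dots> = (\<integral>\<^sup>+v. ennreal y * h (y * v, y) * indicator unit_square (v, y) \<partial>lborel)"
        using True by (intro nn_integral_cong)
          (auto simp: Delta_def unit_square_def indicator_def zero_less_mult_iff mult_less_cancel_left1)
      finally show ?thesis .
    next
      case False
      then show ?thesis
        by (intro nn_integral_cong) (auto simp: Delta_def unit_square_def indicator_def)
    qed
  qed
  also have "\<dots> = (\<integral>\<^sup>+q. ennreal (snd q) * h (snd q * fst q, snd q) * indicator unit_square q \<partial>(lborel \<Otimes>\<^sub>M lborel))"
    by (subst lborel_pair.nn_integral_snd[symmetric]) simp_all
  finally show ?thesis by (simp add: lborel_prod)
qed

lemma set_integral_Delta:
  fixes k :: "real \<times> real \<Rightarrow> real"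
  assumes k: "k \<in> borel_measurable borel"
    and int: "set_integrable lborel unit_square (\<lambda>q. snd q * k (snd q * fst q, snd q))"
  shows "set_integrable lborel Delta k"
    and "(LINT p:Delta|lborel. k p) = (LINT q:unit_square|lborel. snd q * k (snd q * fst q, snd q))"
proof -
  note k[measurable]
  \<comment> \<open>Taking \<open>u\<close> as norm, identity and negation gives integrability and
    the positive and negative parts. Positive homogeneity moves the Jacobian through
    \<open>u\<close>.\<close>
  have nn: "(\<integral>\<^sup>+p. ennreal (u (indicator Delta p *\<^sub>R k p)) \<partial>lborel) =
      (\<integral>\<^sup>+q. ennreal (u (indicator unit_square q *\<^sub>R (snd q * k (snd q * fst q, snd q)))) \<partial>lborel)"
    if [measurable]: "u \<in> borel_measurable borel" and u: "\<And>c x. c \<ge> 0 \<Longrightarrow> u (c * x) = c * u x" for u :: "real \<Rightarrow> real"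
  proof -
    have u0: "u 0 = 0" using u[of 0 0] by simp
    have "(\<integral>\<^sup>+p. ennreal (u (indicator Delta p *\<^sub>R k p)) \<partial>lborel) =
        (\<integral>\<^sup>+p. ennreal (u (k p)) * indicator Delta p \<partial>lborel)"
      using u0 by (intro nn_integral_cong) (auto simp: indicator_def)
    also have "\<dots> = (\<integral>\<^sup>+q. ennreal (snd q) * ennreal (u (k (snd q * fst q, snd q))) * indicator unit_square q \<partial>lborel)"
      by (rule nn_integral_Delta) simp
    also have "\<dots> = (\<integral>\<^sup>+q. ennreal (u (indicator unit_square q *\<^sub>R (snd q * k (snd q * fst q, snd q)))) \<partial>lborel)"
      using u0 by (intro nn_integral_cong) (auto simp: indicator_def unit_square_def u ennreal_mult')
    finally show ?thesis .
  qed
  have norm: "(\<integral>\<^sup>+p. norm (indicator Delta p *\<^sub>R k p) \<partial>lborel) =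
      (\<integral>\<^sup>+q. norm (indicator unit_square q *\<^sub>R (snd q * k (snd q * fst q, snd q))) \<partial>lborel)"
    by (rule nn) (simp_all add: abs_mult)
  show i: "set_integrable lborel Delta k"
    using int unfolding set_integrable_def integrable_iff_bounded norm by simp
  have "(\<integral>\<^sup>+p. ennreal (- (indicator Delta p *\<^sub>R k p)) \<partial>lborel) =
      (\<integral>\<^sup>+q. ennreal (- (indicator unit_square q *\<^sub>R (snd q * k (snd q * fst q, snd q)))) \<partial>lborel)"
    by (rule nn) simp_all
  moreover have "(\<integral>\<^sup>+p. ennreal (indicator Delta p *\<^sub>R k p) \<partial>lborel) =
      (\<integral>\<^sup>+q. ennreal (indicator unit_square q *\<^sub>R (snd q * k (snd q * fst q, snd q))) \<partial>lborel)"
    by (rule nn) simp_all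
  ultimately show "(LINT p:Delta|lborel. k p) =
      (LINT q:unit_square|lborel. snd q * k (snd q * fst q, snd q))"
    unfolding set_lebesgue_integral_def
    using real_lebesgue_integral_def[OF i[unfolded set_integrable_def]]
      real_lebesgue_integral_def[OF int[unfolded set_integrable_def]] by simp
qed

text \<open>The \<open>n\<close>-th moment integrand at \<open>l = 0\<close> after
  \<open>x = y * v\<close>, Jacobian included: the exponent of \<open>y\<close> is
  \<open>1 + n - 4/3\<close>.\<close>

definition square_integrand :: "nat \<Rightarrow> real \<times> real \<Rightarrow> real" where
  "square_integrand n q = fst q ^ n * (1 - fst q) powr (-2/3) *
     (snd q powr (n - 1/3) * (1 - fst q * snd q) powr (-2/3))"

lemma measurable_square_integrand [measurable]: "square_integrand n \<in> borel_measurable borel"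
  unfolding square_integrand_def borel_prod[symmetric] by measurable

lemma inverse_root3_squared:
  assumes "x > (0::real)"
  shows "1 / (root 3 x)\<^sup>2 = x powr (-2/3)"
proof -
  have "(root 3 x)\<^sup>2 = x powr (2/3)"
    using assms by (simp add: root_powr_inverse powr_powr flip: powr_numeral)
  then show ?thesis by (simp add: powr_minus_divide)
qed

text \<open>Isolates the only factor that depends on \<open>l\<close>, so that all moments can be
  taken with respect to \<open>G_integrand 0\<close>.\<close>

lemma G_integrand_split:
  "G_integrand l p = G_integrand 0 p * (1 / (root 3 (1 - l * fst p))\<^sup>2)"
  by (cases p) (simp add: G_integrand_def real_root_mult power_mult_distrib)

lemma G_integrand_nonneg: "G_integrand l p \<ge> 0"
  by (cases p) (simp add: G_integrand_def)

lemma measurable_G_integrand [measurable]: "G_integrand l \<in> borel_measurable borel"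
proof -
  have "G_integrand l = (\<lambda>p. 1 / (root 3 (snd p * (snd p - fst p) * (1 - fst p) * (1 - l * fst p)))\<^sup>2)"
    by (auto simp: G_integrand_def)
  then show ?thesis
    by (simp only:) (intro borel_measurable_divide borel_measurable_const borel_measurable_power
      borel_measurable_continuous_onI continuous_intros)
qed

lemma moment_integrand_eq:
  assumes "q \<in> unit_square"
  shows "snd q * (fst (snd q * fst q, snd q) ^ n * G_integrand 0 (snd q * fst q, snd q)) = square_integrand n q"
proof -
  obtain v y where q: "q = (v, y)" "0 < v" "v < 1" "0 < y" "y < 1"
    using assms by (auto simp: unit_square_def)
  have vy: "y * v < 1" using q by (meson le_less_trans less_eq_real_def mult_left_le)
  have "G_integrand 0 (y * v, y) = (y * (y * (1 - v)) * (1 - y * v)) powr (-2/3)"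
  proof -
    have "y * (y - y * v) * (1 - y * v) * (1 - 0 * (y * v)) = y * (y * (1 - v)) * (1 - y * v)"
      by (simp add: algebra_simps)
    moreover have "y * (y * (1 - v)) * (1 - y * v) > 0" using q vy by simp
    ultimately show ?thesis
      by (simp only: G_integrand_def prod.case inverse_root3_squared)
  qed
  also have "\<dots> = y powr (-4/3) * (1 - v) powr (-2/3) * (1 - y * v) powr (-2/3)"
    using q vy by (simp add: powr_mult powr_add[symmetric])
  finally have "y * ((y * v) ^ n * G_integrand 0 (y * v, y)) =
      (y powr 1 * y powr n * y powr (-4/3)) * (v ^ n * (1 - v) powr (-2/3) * (1 - y * v) powr (-2/3))"
    using q by (simp add: power_mult_distrib powr_realpow)
  also have "y powr 1 * y powr n * y powr (-4/3) = y powr (n - 1/3)"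
    by (simp only: powr_add[symmetric]) (simp add: algebra_simps)
  finally show ?thesis using q by (simp add: square_integrand_def mult_ac)
qed

section \<open>Integrability on the square\<close>

lemma set_integrable_Ioo_Beta:
  assumes "a > -1" "b > (-1::real)"
  shows "set_integrable lborel {0<..<1} (\<lambda>t. t powr a * (1 - t) powr b)"
  using integrable_Beta[of "a + 1" "b + 1"] assms
  by (auto intro: set_integrable_subset)

lemma set_integrable_product:
  fixes f g :: "real \<Rightarrow> real"
  assumes f: "set_integrable lborel A f" and g: "set_integrable lborel B g"
  shows "set_integrable lborel (A \<times> B) (\<lambda>q. f (fst q) * g (snd q))"
proof -
  let ?f = "\<lambda>x. indicator A x * f x" and ?g = "\<lambda>x. indicator B x * g x"
  have i: "integrable lborel ?f" "integrable lborel ?g" using f g by (auto simp: set_integrable_def)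
  note [measurable] = borel_measurable_integrable[OF i(1)] borel_measurable_integrable[OF i(2)]
  have "integrable (lborel \<Otimes>\<^sub>M lborel) (\<lambda>q. ?f (fst q) * ?g (snd q))"
  proof (rule lborel_pair.Fubini_integrable)
    show "integrable lborel (\<lambda>x. \<integral>y. norm (?f (fst (x, y)) * ?g (snd (x, y))) \<partial>lborel)"
    proof -
      have "(\<lambda>x. \<integral>y. norm (?f x * ?g y) \<partial>lborel) = (\<lambda>x. norm (?f x) * (\<integral>y. norm (?g y) \<partial>lborel))"
        by (rule ext) (simp only: norm_mult integral_mult_right_zero mult.assoc)
      then show ?thesis using integrable_mult_left[OF integrable_norm[OF i(1)]] by simp
    qed
    show "AE x in lborel. integrable lborel (\<lambda>y. ?f (fst (x, y)) * ?g (snd (x, y)))"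
      unfolding fst_conv snd_conv by (intro AE_I2 integrable_mult_right i)
  qed measurable
  then have "integrable lborel (\<lambda>q. ?f (fst q) * ?g (snd q))" by (simp add: lborel_prod)
  then show ?thesis unfolding set_integrable_def
    by (rule Bochner_Integration.integrable_cong[THEN iffD1, rotated -1])
      (auto simp: indicator_def)
qed

lemma set_integrable_square_integrand_0: "set_integrable lborel unit_square (square_integrand 0)"
proof (rule set_integrable_bound)
  \<comment> \<open>From \<open>-2/3 = -1/6 - 1/2\<close>: the variable \<open>1 - v\<close> gets
    \<open>-2/3 - 1/6 = -5/6\<close> and \<open>1 - y\<close> gets \<open>-1/2\<close>, both above
    \<open>-1\<close>. The factor \<open>t powr 0\<close> only fits the Beta form.\<close>
  have "set_integrable lborel {0<..<1} (\<lambda>t::real. t powr 0 * (1 - t) powr (-5/6))"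
    "set_integrable lborel {0<..<1} (\<lambda>t::real. t powr (-1/3) * (1 - t) powr (-1/2))"
    by (rule set_integrable_Ioo_Beta; simp)+
  from set_integrable_product[OF this]
  show "set_integrable lborel unit_square (\<lambda>q. fst q powr 0 * (1 - fst q) powr (-5/6) *
      (snd q powr (-1/3) * (1 - snd q) powr (-1/2)))"
    by (simp only: unit_square_def)
  show "set_borel_measurable lborel unit_square (square_integrand 0)"
    unfolding set_borel_measurable_def by measurable
  show "AE q in lborel. q \<in> unit_square \<longrightarrow> norm (square_integrand 0 q) \<le>
      norm (fst q powr 0 * (1 - fst q) powr (-5/6) * (snd q powr (-1/3) * (1 - snd q) powr (-1/2)))"
  proof (intro AE_I2 impI)
    fix q assume "q \<in> unit_square"
    then obtain v y where q: "q = (v, y)" "0 < v" "v < 1" "0 < y" "y < 1"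
      by (auto simp: unit_square_def)
    \<comment> \<open>Bounding \<open>1 - v y\<close> below by \<open>1 - v\<close> alone would give the non-integrable exponent \<open>-4/3\<close>; so the
      exponent is split between \<open>1 - v\<close> and \<open>1 - y\<close>.\<close>
    have le: "1 - v \<le> 1 - v * y" "1 - y \<le> 1 - v * y" using q by (auto simp: mult_left_le mult_left_le_one_le)
    have "(1 - v * y) powr (-2/3) = (1 - v * y) powr (-1/6) * (1 - v * y) powr (-1/2)"
      by (simp flip: powr_add)
    also have "\<dots> \<le> (1 - v) powr (-1/6) * (1 - y) powr (-1/2)"
      using q le by (intro mult_mono powr_mono2') auto
    finally have "(1 - v) powr (-2/3) * (y powr (-1/3) * (1 - v * y) powr (-2/3)) \<le>
        (1 - v) powr (-2/3) * (y powr (-1/3) * ((1 - v) powr (-1/6) * (1 - y) powr (-1/2)))"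
      by (intro mult_left_mono) auto
    also have "\<dots> = ((1 - v) powr (-2/3) * (1 - v) powr (-1/6)) * (y powr (-1/3) * (1 - y) powr (-1/2))"
      by (simp only: mult_ac)
    also have "(1 - v) powr (-2/3) * (1 - v) powr (-1/6) = (1 - v) powr (-5/6)"
      by (simp flip: powr_add)
    finally show "norm (square_integrand 0 q) \<le>
      norm (fst q powr 0 * (1 - fst q) powr (-5/6) * (snd q powr (-1/3) * (1 - snd q) powr (-1/2)))"
      using q by (simp add: square_integrand_def abs_mult)
  qed
qed

lemma set_integrable_square_integrand: "set_integrable lborel unit_square (square_integrand n)"
proof (rule set_integrable_bound[OF set_integrable_square_integrand_0])
  show "set_borel_measurable lborel unit_square (square_integrand n)"
    unfolding set_borel_measurable_def by measurable
  show "AE q in lborel. q \<in> unit_square \<longrightarrow> norm (square_integrand n q) \<le> norm (square_integrand 0 q)"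
  proof (intro AE_I2 impI)
    fix q assume "q \<in> unit_square"
    then obtain v y where q: "q = (v, y)" "0 < v" "v < 1" "0 < y" "y < 1"
      by (auto simp: unit_square_def)
    have "y powr (n - 1/3) \<le> y powr (0 - 1/3)" using q by (intro powr_mono') auto
    moreover have "v ^ n \<le> v ^ 0" using q by (simp add: power_le_one)
    ultimately have "v ^ n * (1 - v) powr (-2/3) * (y powr (n - 1/3) * (1 - v * y) powr (-2/3)) \<le>
        v ^ 0 * (1 - v) powr (-2/3) * (y powr (0 - 1/3) * (1 - v * y) powr (-2/3))"
      using q by (intro mult_mono mult_nonneg_nonneg) auto
    then show "norm (square_integrand n q) \<le> norm (square_integrand 0 q)"
      using q by (simp add: square_integrand_def abs_mult)
  qed
qed

section \<open>Moments and their recurrence\<close>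

definition moment :: "nat \<Rightarrow> real" where
  "moment n = (LINT p:Delta|lborel. fst p ^ n * G_integrand 0 p)"

lemma
  shows set_integrable_moment: "set_integrable lborel Delta (\<lambda>p. fst p ^ n * G_integrand 0 p)"
    and moment_eq: "moment n = (LINT q:unit_square|lborel. square_integrand n q)"
proof -
  have m: "(\<lambda>p. fst p ^ n * G_integrand 0 p) \<in> borel_measurable borel"
    by (intro borel_measurable_times borel_measurable_power measurable_G_integrand
        borel_measurable_continuous_onI continuous_intros)
  have i: "set_integrable lborel unit_square
      (\<lambda>q. snd q * (fst (snd q * fst q, snd q) ^ n * G_integrand 0 (snd q * fst q, snd q)))"
    using set_integrable_square_integrand[of n] moment_integrand_eq
    by (subst set_integrable_cong[OF refl refl]) auto
  show "set_integrable lborel Delta (\<lambda>p. fst p ^ n * G_integrand 0 p)"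
    by (rule set_integral_Delta(1)[OF m i])
  show "moment n = (LINT q:unit_square|lborel. square_integrand n q)"
    unfolding moment_def set_integral_Delta(2)[OF m i]
    by (intro set_lebesgue_integral_cong allI impI moment_integrand_eq) simp_all
qed

text \<open>\<open>D\<close> is the derivative of \<open>y^(n + 2/3) (1 - v y)^(1/3)\<close>: the
  bracket is \<open>(n + 2/3) (1 - v y) - v y / 3\<close>. The primitive vanishes at
  \<open>0\<close>, so only its value at \<open>1\<close> remains. \<open>int\<close> turns the
  gauge integral of the fundamental theorem into a Lebesgue integral.\<close>

lemma set_integral_square_fibre:
  fixes v :: real and n :: nat
  assumes v: "0 < v" "v < 1"
  defines "D \<equiv> \<lambda>y. y powr (real n - 1/3) * (1 - v * y) powr (-2/3) * ((real n + 2/3) - (real n + 1) * (v * y))"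
  assumes int: "set_integrable lborel {0<..<1} D"
  shows "(LINT y:{0<..<1}|lborel. D y) = (1 - v) powr (1/3)"
proof -
  let ?f = "\<lambda>y. y powr (real n + 2/3) * (1 - v * y) powr (1/3)"
  have "(D has_integral (?f 1 - ?f 0)) {0..1}"
  proof (rule fundamental_theorem_of_calculus_interior)
    have pos: "1 - v * y > 0" if "y \<in> {0..1}" for y
    proof -
      have "v * y \<le> v" using v that by (simp add: mult_left_le)
      then show ?thesis using v by linarith
    qed
    then have "v * y \<le> 1" if "0 \<le> y" "y \<le> 1" for y using that less_imp_le by fastforce
    then show "continuous_on {0..1} ?f"
      by (intro continuous_on_mult continuous_on_powr' continuous_intros) auto
    fix y :: real assume y: "y \<in> {0<..<1}"
    then have vy: "1 - v * y > 0" using pos by simp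
    have "(?f has_real_derivative ((real n + 2/3) * y powr (n + 2/3 - 1)) * (1 - v * y) powr (1/3)
        + ((1/3) * (1 - v * y) powr (1/3 - 1) * (- v)) * y powr (real n + 2/3)) (at y)"
      using y vy by (auto intro!: derivative_eq_intros simp: field_simps)
    also have "((real n + 2/3) * y powr (n + 2/3 - 1)) * (1 - v * y) powr (1/3)
        + ((1/3) * (1 - v * y) powr (1/3 - 1) * (- v)) * y powr (real n + 2/3) = D y"
    proof -
      have 1: "y powr (real n + 2/3) = y * y powr (n - 1/3)"
        using y powr_add[of y 1 "n - 1/3"] by (simp add: algebra_simps)
      have 2: "(1 - v * y) powr (1/3) = (1 - v * y) * (1 - v * y) powr (-2/3)"
        using vy powr_add[of "1 - v * y" 1 "-2/3"] by simp
      show ?thesis unfolding D_def 1 2 by (simp add: algebra_simps)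
    qed
    finally show "(?f has_vector_derivative D y) (at y)"
      by (simp add: has_real_derivative_iff_has_vector_derivative)
  qed simp
  then have "(D has_integral (1 - v) powr (1/3)) {0<..<1}" by (simp add: has_integral_Icc_iff_Ioo)
  then have "integral {0<..<1} D = (1 - v) powr (1/3)" by (rule integral_unique)
  then show ?thesis using set_borel_integral_eq_integral(2)[OF int] by simp
qed

text \<open>Integrating the fibre value \<open>(1 - v)^(1/3)\<close> against
  \<open>v^n (1 - v)^(-2/3)\<close> gives \<open>Beta (n + 1) (2/3)\<close>, which is the right-hand
  side.\<close>

lemma moment_recurrence:
  "(real n + 2/3) * moment n - (real n + 1) * moment (Suc n) = fact n / pochhammer (2/3) (Suc n)"
proof -
  let ?D = "\<lambda>v y :: real. y powr (real n - 1/3) * (1 - v * y) powr (-2/3) * ((real n + 2/3) - (real n + 1) * (v * y))"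
  let ?c = "\<lambda>v::real. v ^ n * (1 - v) powr (-2/3)"
  let ?I = "indicator {0<..<1} :: real \<Rightarrow> real"
  define K where "K = (\<lambda>v y. (?I v * ?c v) * (?I y * ?D v y))"
  have eq: "indicator unit_square q *\<^sub>R ((real n + 2/3) * square_integrand n q - (real n + 1) * square_integrand (Suc n) q)
      = case_prod K q" for q :: "real \<times> real"
  proof (cases "q \<in> unit_square")
    case True
    then obtain v y where q: "q = (v, y)" "0 < v" "v < 1" "0 < y" "y < 1"
      by (auto simp: unit_square_def)
    have "y powr (Suc n - 1/3) = y * y powr (n - 1/3)"
      using q powr_add[of y 1 "n - 1/3"] by (simp add: algebra_simps)
    then show ?thesis using True q by (simp add: K_def square_integrand_def algebra_simps)
  next
    case False
    then show ?thesis by (auto simp: K_def unit_square_def indicator_def split: prod.splits)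
  qed
  have i1: "set_integrable lborel unit_square
      (\<lambda>q. (real n + 2/3) * square_integrand n q - (real n + 1) * square_integrand (Suc n) q)"
    by (intro set_integral_diff set_integrable_mult_right set_integrable_square_integrand)
  have "(real n + 2/3) * moment n - (real n + 1) * moment (Suc n) = (LINT q:unit_square|lborel.
      (real n + 2/3) * square_integrand n q - (real n + 1) * square_integrand (Suc n) q)"
    unfolding moment_eq
    by (subst set_integral_diff(2)) (auto intro!: set_integrable_square_integrand)
  also have "\<dots> = integral\<^sup>L (lborel \<Otimes>\<^sub>M lborel) (case_prod K)"
    unfolding set_lebesgue_integral_def eq by (simp add: lborel_prod)
  also have iK: "integrable (lborel \<Otimes>\<^sub>M lborel) (case_prod K)"
    using i1 unfolding set_integrable_def eq by (simp add: lborel_prod)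
  then have "integral\<^sup>L (lborel \<Otimes>\<^sub>M lborel) (case_prod K) = (\<integral>v. (\<integral>y. K v y \<partial>lborel) \<partial>lborel)"
    by (rule lborel_pair.integral_fst[symmetric])
  \<comment> \<open>Fubini yields integrable fibres for almost every \<open>v\<close>, which is the
    hypothesis of the fibre computation; hence the comparison is almost everywhere.\<close>
  also have "\<dots> = (\<integral>v. ?I v * (v powr n * (1 - v) powr (-1/3)) \<partial>lborel)"
  proof (rule integral_cong_AE)
    show "(\<lambda>v. \<integral>y. K v y \<partial>lborel) \<in> borel_measurable lborel"
      using lborel_pair.integrable_fst[OF iK] by (rule borel_measurable_integrable)
    show "AE v in lborel. (\<integral>y. K v y \<partial>lborel) = ?I v * (v powr n * (1 - v) powr (-1/3))"
      using lborel_pair.AE_integrable_fst[OF iK]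
    proof eventually_elim
      case (elim v)
      show ?case
      proof (cases "v \<in> {0<..<1}")
        case True
        then have v: "0 < v" "v < 1" by auto
        have "integrable lborel (\<lambda>y. ?c v * (?I y * ?D v y))" using elim True by (simp add: K_def)
        then have "set_integrable lborel {0<..<1} (?D v)"
          unfolding set_integrable_def using v by (simp add: integrable_mult_right_iff)
        from set_integral_square_fibre[OF v this]
        have "(\<integral>y. ?I y * ?D v y \<partial>lborel) = (1 - v) powr (1/3)" by (simp add: set_lebesgue_integral_def)
        moreover have "(1 - v) powr (-2/3) * (1 - v) powr (1/3) = (1 - v) powr (-1/3)"
          by (simp flip: powr_add)
        ultimately show ?thesis using True v by (simp add: K_def powr_realpow mult.assoc)
      qed (simp add: K_def)
    qed
  qed simp
  also have "\<dots> = integral {0<..<1} (\<lambda>v. v powr n * (1 - v) powr (-1/3))"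
    using set_borel_integral_eq_integral(2)[OF set_integrable_Ioo_Beta[of n "-1/3"]]
    by (simp add: set_lebesgue_integral_def)
  also have "\<dots> = Beta (real n + 1) (2/3)"
    using has_integral_Beta_real[of "real n + 1" "2/3"]
    by (intro integral_unique) (simp add: has_integral_Icc_iff_Ioo)
  also have "\<dots> = fact n / pochhammer (2/3) (Suc n)"
  proof -
    have "(2/3::real) \<notin> \<int>\<^sub>\<le>\<^sub>0" by (auto elim!: nonpos_Ints_cases)
    then have "pochhammer (2/3) (Suc n) = Gamma (2/3 + real (Suc n)) / Gamma (2/3)"
      by (rule pochhammer_Gamma)
    moreover have "Gamma (real n + 1) = fact n" using Gamma_fact[of n, where 'a = real] by (simp add: add.commute)
    ultimately show ?thesis by (simp add: Beta_def algebra_simps)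
  qed
  finally show ?thesis .
qed

section \<open>Power series coefficients of the integral\<close>

definition G_coeff :: "nat \<Rightarrow> real" where
  "G_coeff n = pochhammer (2/3) n / fact n * moment n"

text \<open>Multiply the moment recurrence by \<open>pochhammer (2/3) (Suc n) / n!\<close>: the Beta
  term is the reciprocal of this factor and becomes \<open>1\<close>.\<close>

lemma G_coeff_recurrence:
  "(real n + 1)\<^sup>2 * G_coeff (Suc n) - (real n + 2/3)\<^sup>2 * G_coeff n = -1"
proof -
  define P where "P = pochhammer (2/3 :: real) n"
  have P: "P > 0" by (simp add: P_def pochhammer_pos)
  have r: "(real n + 1) * moment (Suc n) = (real n + 2/3) * moment n - fact n / (P * (real n + 2/3))"
    using moment_recurrence[of n] by (simp add: P_def pochhammer_Suc algebra_simps)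
  have e: "G_coeff (Suc n) = P * (real n + 2/3) / (fact n * (real n + 1)) * moment (Suc n)"
    by (simp add: G_coeff_def P_def pochhammer_Suc algebra_simps)
  have "a\<^sup>2 * (x / (fact n * a) * y) = x / fact n * (a * y)" if "a \<noteq> 0" for a x y :: real
    using that by (simp add: power2_eq_square field_simps)
  from this[of "real n + 1"]
  have "(real n + 1)\<^sup>2 * G_coeff (Suc n) = P * (real n + 2/3) / fact n * ((real n + 1) * moment (Suc n))"
    unfolding e by (simp del: distrib_left)
  also have "\<dots> = (real n + 2/3)\<^sup>2 * G_coeff n - 1"
  proof -
    have "P * b / fact n * (b * x - fact n / (P * b)) = b\<^sup>2 * (P / fact n * x) - 1" if "b > 0" for b x :: real
      using P that by (simp add: power2_eq_square right_diff_distrib)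
    from this[of "real n + 2/3"] show ?thesis unfolding r G_coeff_def P_def[symmetric] by simp
  qed
  finally show ?thesis by simp
qed

text \<open>Consecutive terms have ratio \<open>(n + 2/3) / (n + 1) <= 1\<close>. With the bounded
  moments this bounds \<open>G_coeff\<close>, hence convergence in the unit disc.\<close>

lemma pochhammer_over_fact_bounds:
  "0 \<le> pochhammer (2/3 :: real) n / fact n \<and> pochhammer (2/3 :: real) n / fact n \<le> 1"
proof (induction n)
  case (Suc n)
  have "pochhammer (2/3 :: real) (Suc n) / fact (Suc n) =
      pochhammer (2/3) n / fact n * ((2/3 + n) / (real n + 1))"
    by (simp add: pochhammer_Suc field_simps)
  moreover have "0 \<le> (2/3 + real n) / (real n + 1)" "(2/3 + real n) / (real n + 1) \<le> 1" by simp_all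
  ultimately show ?case
    by (simp only:) (intro conjI mult_nonneg_nonneg mult_le_one; use Suc in simp)
qed simp

lemma moment_bounds: "0 \<le> moment n" "moment n \<le> moment 0"
proof -
  show "0 \<le> moment n" unfolding moment_def set_lebesgue_integral_def
    by (intro integral_nonneg_AE AE_I2) (auto simp: indicator_def Delta_def G_integrand_nonneg)
  show "moment n \<le> moment 0" unfolding moment_def
    by (intro set_integral_mono set_integrable_moment mult_right_mono G_integrand_nonneg)
      (auto simp: Delta_def power_le_one)
qed

lemma binomial_series:
  fixes t :: real
  assumes "0 \<le> t" "t < 1"
  shows "(\<lambda>n. pochhammer (2/3) n / fact n * t ^ n) sums ((1 - t) powr (-2/3))"
proof -
  have "(\<lambda>n. ((-2/3) gchoose n) * (-t) ^ n) sums (1 + (-t)) powr (-2/3)"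
    using assms by (intro gen_binomial_real) simp
  also have "(\<lambda>n. ((-2/3) gchoose n) * (-t) ^ n) = (\<lambda>n. pochhammer (2/3) n / fact n * t ^ n)"
    by (rule ext) (simp add: gbinomial_pochhammer power_minus[of t] field_simps flip: power_add mult_2)
  finally show ?thesis by simp
qed

text \<open>All terms of the expanded integrand are nonnegative and their integrals are summable, so
  termwise integration gives integrability and the value together.\<close>

lemma
  assumes l: "0 < l" "l < 1"
  shows set_integrable_G_integrand: "set_integrable lborel Delta (G_integrand l)"
    and G_sums: "(\<lambda>n. G_coeff n * l ^ n) sums (LINT p:Delta|lborel. G_integrand l p)"
proof -
  define \<alpha> where "\<alpha> n = pochhammer (2/3 :: real) n / fact n" for n
  have \<alpha>: "0 \<le> \<alpha> n" "\<alpha> n \<le> 1" for n using pochhammer_over_fact_bounds by (auto simp: \<alpha>_def)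
  define f where "f n p = indicator Delta p *\<^sub>R (\<alpha> n * l ^ n * (fst p ^ n * G_integrand 0 p))" for n p
  have fint: "integrable lborel (f n)" for n
    using set_integrable_mult_right[OF set_integrable_moment[of n], of "\<alpha> n * l ^ n"]
    by (simp add: f_def[abs_def] set_integrable_def)
  have f0: "norm (f n p) = f n p" for n p
    using l \<alpha>(1)[of n] by (auto simp: f_def indicator_def Delta_def G_integrand_nonneg)
  have fI: "integral\<^sup>L lborel (f n) = G_coeff n * l ^ n" for n
  proof -
    have "integral\<^sup>L lborel (f n) = (LINT p:Delta|lborel. \<alpha> n * l ^ n * (fst p ^ n * G_integrand 0 p))"
      unfolding f_def set_lebesgue_integral_def by (rule refl)
    also have "\<dots> = \<alpha> n * l ^ n * moment n" unfolding moment_def by (rule set_integral_mult_right)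
    finally show ?thesis by (simp add: G_coeff_def \<alpha>_def)
  qed
  have fs: "(\<lambda>n. f n p) sums (indicator Delta p *\<^sub>R G_integrand l p)" for p
  proof (cases "p \<in> Delta")
    case True
    then have x: "0 < fst p" "fst p < 1" by (auto simp: Delta_def)
    then have lx: "0 \<le> l * fst p" "l * fst p < 1" using l mult_strict_mono[of l 1 "fst p" 1] by simp_all
    have "(\<lambda>n. G_integrand 0 p * (\<alpha> n * (l * fst p) ^ n)) sums (G_integrand 0 p * (1 - l * fst p) powr (-2/3))"
      unfolding \<alpha>_def by (intro sums_mult binomial_series lx)
    also have "G_integrand 0 p * (1 - l * fst p) powr (-2/3) = G_integrand l p"
      using lx inverse_root3_squared[of "1 - l * fst p"] G_integrand_split[of l p] by simp
    finally show ?thesis using True by (simp add: f_def power_mult_distrib mult_ac)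
  qed (simp add: f_def)
  have sum: "summable (\<lambda>n. G_coeff n * l ^ n)"
  proof (rule summable_comparison_test')
    show "summable (\<lambda>n. moment 0 * l ^ n)" using l by (intro summable_mult summable_geometric) auto
    show "norm (G_coeff n * l ^ n) \<le> moment 0 * l ^ n" for n
    proof -
      have "\<alpha> n * moment n \<le> 1 * moment 0" using \<alpha> moment_bounds by (intro mult_mono) auto
      then show ?thesis using l \<alpha>(1)[of n] moment_bounds(1)[of n]
        by (simp add: G_coeff_def \<alpha>_def[symmetric] abs_mult mult_right_mono)
    qed
  qed
  have s1: "AE p in lborel. summable (\<lambda>n. norm (f n p))"
    unfolding f0 by (intro AE_I2 sums_summable[OF fs])
  have s2: "summable (\<lambda>n. \<integral>p. norm (f n p) \<partial>lborel)" unfolding f0 fI by (rule sum)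
  have lim: "(\<lambda>p. \<Sum>n. f n p) = (\<lambda>p. indicator Delta p *\<^sub>R G_integrand l p)"
    using fs by (simp add: sums_iff)
  show "set_integrable lborel Delta (G_integrand l)"
    using integrable_suminf[OF fint s1 s2] unfolding lim set_integrable_def .
  show "(\<lambda>n. G_coeff n * l ^ n) sums (LINT p:Delta|lborel. G_integrand l p)"
    using integral_suminf[OF fint s1 s2] sum
    unfolding lim set_lebesgue_integral_def by (simp add: fI sums_iff)
qed

section \<open>The branches of G\<close>

definition G_series :: "complex fps" where
  "G_series = Abs_fps (\<lambda>n. (1 - zeta) * of_real (G_coeff n))"

lemma G_coeff_bounds: "0 \<le> G_coeff n" "G_coeff n \<le> moment 0"
proof -
  show "0 \<le> G_coeff n"
    using pochhammer_over_fact_bounds[of n] moment_bounds(1)[of n]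
    unfolding G_coeff_def by (intro mult_nonneg_nonneg) auto
  have "G_coeff n \<le> 1 * moment 0"
    using pochhammer_over_fact_bounds[of n] moment_bounds[of n]
    unfolding G_coeff_def by (intro mult_mono) auto
  then show "G_coeff n \<le> moment 0" by simp
qed

lemma fps_conv_radius_G_series: "fps_conv_radius G_series \<ge> 1"
proof -
  have "norm (G_series $ n) \<le> norm (1 - zeta) * moment 0 * 1 ^ n" for n
    using G_coeff_bounds[of n] by (simp add: G_series_def norm_mult mult_left_mono)
  from fps_conv_radius_ge_geometric[OF this] show ?thesis by (simp add: one_ereal_def)
qed

lemma holomorphic_G_series: "eval_fps G_series holomorphic_on ball 0 1"
  using eball_mono[OF fps_conv_radius_G_series, of 0]
  by (intro holomorphic_on_eval_fps) (simp add: one_ereal_def)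

lemma eval_G_series:
  assumes "0 < l" "l < 1"
  shows "eval_fps G_series (of_real l) = G l"
proof -
  have "(\<lambda>n. (1 - zeta) * of_real (G_coeff n * l ^ n)) sums G l"
    unfolding G_def by (intro sums_mult sums_of_real G_sums assms)
  then show ?thesis by (simp add: eval_fps_def G_series_def sums_iff mult.assoc)
qed

text \<open>At \<open>a = 0\<close> the coefficient recurrence is the equation itself, with
  inhomogeneity the constant sequence \<open>zeta - 1\<close>. This gives the equation near
  \<open>0\<close>, and the identity theorem spreads it over the unit disc.\<close>

lemma hypergeometric_defect_G_series:
  assumes "norm z < 1"
  shows "hypergeometric_defect (eval_fps G_series) z = 0"
proof -
  have h: "hypergeometric_fps 0 G_series = fps_const (zeta - 1) * Abs_fps (\<lambda>_. 1)"
  proof (rule fps_ext)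
    fix n
    have "hypergeometric_fps 0 G_series $ n = (1 - zeta) *
        of_real ((real n + 1)\<^sup>2 * G_coeff (Suc n) - (real n + 2/3)\<^sup>2 * G_coeff n)"
      by (simp add: hypergeometric_fps_nth G_series_def power2_eq_square algebra_simps)
    then show "hypergeometric_fps 0 G_series $ n = (fps_const (zeta - 1) * Abs_fps (\<lambda>_. 1)) $ n"
      unfolding G_coeff_recurrence by simp
  qed
  \<comment> \<open>The factor \<open>X - 1\<close> of the defect telescopes the geometric series,
    which turns \<open>zeta - 1\<close> into \<open>1 - zeta\<close>.\<close>
  have "(fps_const (0 - 1) + fps_X) * Abs_fps (\<lambda>_. 1) = (fps_const (- 1) :: complex fps)"
  proof (rule fps_ext)
    fix n show "((fps_const (0 - 1) + fps_X) * Abs_fps (\<lambda>_. 1)) $ n = (fps_const (- 1) :: complex fps) $ n"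
      by (cases n) (simp_all add: ring_distribs)
  qed
  then have "(fps_const (0 - 1) + fps_X) * hypergeometric_fps 0 G_series = fps_const (1 - zeta)"
    unfolding h mult.left_commute[of _ "fps_const (zeta - 1)"] by (simp add: fps_const_mult)
  moreover have "fps_conv_radius G_series > 0"
    using fps_conv_radius_G_series by (rule less_le_trans[rotated]) simp
  then have "(\<lambda>w. eval_fps G_series (0 + w)) has_fps_expansion G_series"
    by (simp add: eval_fps_has_fps_expansion)
  ultimately have ev: "\<forall>\<^sub>F w in nhds 0. hypergeometric_defect (eval_fps G_series) w = 0"
    using hypergeometric_defect_eventually_0_iff by blast
  from hypergeometric_defect_identity[OF holomorphic_G_series _ _ _ ev] show ?thesis
    using assms by simp
qed

text \<open>The unit disc contains the excluded point \<open>0\<close>. The disc with diameter from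
  \<open>0\<close> to \<open>1\<close> avoids both singular points and still contains the whole real
  interval.\<close>

lemma solution_element_G_series: "solution_element (ball (1/2) (1/2), eval_fps G_series)"
proof -
  have sub: "ball (1/2) (1/2) \<subseteq> ball (0::complex) 1"
  proof
    fix z :: complex assume "z \<in> ball (1/2) (1/2)"
    then have "norm (z - 1/2) < 1/2" by (simp add: dist_norm norm_minus_commute)
    moreover have "norm z \<le> norm (z - 1/2) + norm (1/2 :: complex)"
      using norm_triangle_ineq[of "z - 1/2" "1/2"] by simp
    ultimately show "z \<in> ball 0 1" by simp
  qed
  then have "eval_fps G_series holomorphic_on ball (1/2) (1/2)"
    by (rule holomorphic_on_subset[OF holomorphic_G_series])
  moreover have "hypergeometric_defect (eval_fps G_series) z = 0" if "z \<in> ball (1/2) (1/2)" for z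
    using that sub by (intro hypergeometric_defect_G_series) (auto simp: subset_iff)
  ultimately show ?thesis
    by (auto simp: solution_element_def function_element_def dist_norm)
qed

text \<open>Integrability is claimed too because the Lebesgue integral of a non-integrable function
  would silently be \<open>0\<close>; it ensures that \<open>G\<close> is the intended convergent
  integral.\<close>

theorem proposition7p6:
  shows "(\<forall>l\<in>{0<..<1}. set_integrable lborel Delta (G_integrand l)) \<and>
    (\<exists>M. multivalued_holomorphic_on (UNIV - {0, 1}) M \<and>
       (\<exists>(D, g)\<in>M. \<forall>l\<in>{0<..<1}. complex_of_real l \<in> D \<and> g (complex_of_real l) = G l) \<and>
       (\<forall>(D, g)\<in>M. \<forall>z\<in>D.
          z * (1 - z) * (deriv ^^ 2) g z + (1 - 7 / 3 * z) * deriv g z - 4 / 9 * g z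
            = (1 - zeta) / (z - 1)))"
proof (intro conjI exI)
  let ?e = "(ball (1/2) (1/2), eval_fps G_series)"
  let ?R = "\<lambda>e e'. solution_element e \<and> solution_element e' \<and> germ_related e e'"
  let ?M = "{e. ?R\<^sup>*\<^sup>* ?e e}"
  show "\<forall>l\<in>{0<..<1}. set_integrable lborel Delta (G_integrand l)"
    using set_integrable_G_integrand by simp
  show "multivalued_holomorphic_on (UNIV - {0, 1}) ?M"
    by (rule multivalued_holomorphic_on_component)
      (use solution_element_extends solution_element_G_series in \<open>auto simp: solution_element_def\<close>)
  show "\<exists>(D, g)\<in>?M. \<forall>l\<in>{0<..<1}. complex_of_real l \<in> D \<and> g (complex_of_real l) = G l"
  proof (rule bexI[of _ ?e])
    have "complex_of_real l \<in> ball (1/2) (1/2)" if "0 < l" "l < 1" for l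
    proof -
      have "1/2 - complex_of_real l = of_real (1/2 - l)" by simp
      then have "dist (1/2) (complex_of_real l) = \<bar>1/2 - l\<bar>"
        by (simp only: dist_norm norm_of_real)
      moreover have "\<bar>1/2 - l\<bar> < 1/2" using that by linarith
      ultimately show ?thesis by (simp only: mem_ball)
    qed
    then show "case ?e of (D, g) \<Rightarrow> \<forall>l\<in>{0<..<1}. complex_of_real l \<in> D \<and> g (complex_of_real l) = G l"
      by (simp add: eval_G_series)
  qed simp
  show "\<forall>(D, g)\<in>?M. \<forall>z\<in>D.
      z * (1 - z) * (deriv ^^ 2) g z + (1 - 7 / 3 * z) * deriv g z - 4 / 9 * g z
        = (1 - zeta) / (z - 1)"
  proof clarify
    fix D g z assume "?R\<^sup>*\<^sup>* ?e (D, g)" and z: "z \<in> D"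
    \<comment> \<open>Either the chain is trivial, or its last link has \<open>(D, g)\<close> as
      target and carries the solution property.\<close>
    then have "solution_element (D, g)"
      by (cases rule: rtranclp.cases) (use solution_element_G_series in auto)
    then have "z \<noteq> 1" "hypergeometric_defect g z = 0" using z by (auto simp: solution_element_def)
    then show "z * (1 - z) * (deriv ^^ 2) g z + (1 - 7 / 3 * z) * deriv g z - 4 / 9 * g z
        = (1 - zeta) / (z - 1)"
      by (simp add: hypergeometric_defect_eq_0_iff)
  qed
qed

end
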